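(* Let $(\mathcal{M},\boldsymbol{g})$ be a four-dimensional, oriented and time-oriented space-time of signature $(+,-,-,-)$, let $\boldsymbol{F}\in\Omega^2(\mathcal{M})$ be an arbitrary regular solution of the source-free Maxwell equations $d\boldsymbol{F}=0$, $d\star_g\boldsymbol{F}=0$, and let $\tilde{\boldsymbol{g}}=-\kappa_g^{-1}\left(\boldsymbol{F}^{2_g}+\frac{\psi_g}{2}\boldsymbol{g}\right)$ be the disformal metric. Then there exists a pseudo-orthonormal tetrad field $\{\boldsymbol{e}_\mu\}=\{\boldsymbol{e}_0,\boldsymbol{e}_1,\boldsymbol{e}_2,\boldsymbol{e}_3\}$ such that $$\boldsymbol{g}(\boldsymbol{e}_\mu,\boldsymbol{e}_\nu)=\mathrm{diag}(+1,-1,-1,-1),\qquad \tilde{\boldsymbol{g}}(\boldsymbol{e}_\mu,\boldsymbol{e}_\nu)=\mathrm{diag}(-1,+1,-1,-1).$$ This basis is such that $\{\boldsymbol{e}_0,\boldsymbol{e}_1\}$ coincides with an appropriate wrench pair $\{\boldsymbol{X},\boldsymbol{W}\}$ for the field, with $\{\boldsymbol{e}_1,\boldsymbol{e}_2,\boldsymbol{e}_3\}$ forming a right-handed triad in $\boldsymbol{X}^{\perp_g}$. Consequently, with respect to $\tilde{\boldsymbol{g}}$, $\boldsymbol{e}_1$ is time-like whereas $\boldsymbol{e}_0$ is space-like; the electric and magnetic 3-vectors are time-like in $(\mathcal{M},\tilde{\boldsymbol{g}})$.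
   Context: Conventions. For a Lorentzian metric $\boldsymbol{h}$ of signature $(+,-,-,-)$ on the oriented 4-manifold $\mathcal{M}$, with $h=\det(h_{ab})$ and $[abcd]$ the Levi-Civita permutation symbol with $[0123]=1$, the Hodge dual of a 2-form $\boldsymbol{G}$ is $\star_{h}G_{ab}=\frac12\sqrt{-h}\,[abcd](h^{-1})^{cp}(h^{-1})^{dq}G_{pq}$, and the inner product of 2-forms is $\langle\boldsymbol{G},\boldsymbol{H}\rangle_h=\frac12(h^{-1})^{ac}(h^{-1})^{bd}G_{ab}H_{cd}$. Also $(\boldsymbol{F}^{2_h})_{ab}=F_{ac}(h^{-1})^{cd}F_{db}$. $\Omega^2(\mathcal{M})$ is the space of smooth 2-forms on $\mathcal{M}$. Invariants of $\boldsymbol{F}$: $\psi_g=\langle\boldsymbol{F},\boldsymbol{F}\rangle_g$, $\phi_g=\langle\boldsymbol{F},\star_g\boldsymbol{F}\rangle_g$, $\kappa_g=\frac12\sqrt{\psi_g^2+\phi_g^2}$. $\boldsymbol{F}$ is regular if $\kappa_g\neq0$ (at every point). A vector $\boldsymbol{V}$ with $\boldsymbol{h}(\boldsymbol{V},\boldsymbol{V})>0$ (resp. $<0$) is time-like (resp. space-like) for $\boldsymbol{h}$. For a vector $\boldsymbol{V}$, $\boldsymbol{V}^{\flat_g}=\boldsymbol{g}(\cdot,\boldsymbol{V})$, $(i_{\boldsymbol{V}}\boldsymbol{F})_a=V^bF_{ba}$, and $\boldsymbol{V}^{\perp_g}$ is its $\boldsymbol{g}$-orthogonal complement. An observer is a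 future-directed vector $\boldsymbol{X}$ with $\boldsymbol{g}(\boldsymbol{X},\boldsymbol{X})=1$; the electric and magnetic 3-vectors $\boldsymbol{E},\boldsymbol{B}\in\boldsymbol{X}^{\perp_g}$ it measures are defined by $\boldsymbol{E}^{\flat_g}=-i_{\boldsymbol{X}}\boldsymbol{F}$, $\boldsymbol{B}^{\flat_g}=i_{\boldsymbol{X}}\star_g\boldsymbol{F}$. For regular $\boldsymbol{F}$ there is an observer $\boldsymbol{X}$ for which $\boldsymbol{E}$ and $\boldsymbol{B}$ lie on the same line in $\boldsymbol{X}^{\perp_g}$, so that $\boldsymbol{E}=\alpha\boldsymbol{W}$, $\boldsymbol{B}=\beta\boldsymbol{W}$ with $\alpha,\beta\in\mathbb{R}$, $\boldsymbol{W}\in\boldsymbol{X}^{\perp_g}$, $\boldsymbol{g}(\boldsymbol{W},\boldsymbol{W})=-1$. Since $\boldsymbol{W}$ is defined up to a sign, it is assumed that $\alpha>0$ if $\psi_g\leq0$ and $\beta>0$ if $\psi_g>0$. Such an $\boldsymbol{X}$ is called a wrench observer, $\boldsymbol{W}$ a wrench 3-vector, and $\{\boldsymbol{X},\boldsymbol{W}\}$ a wrench pair. The triad $\{\boldsymbol{e}_1,\boldsymbol{e}_2,\boldsymbol{e}_3\}$ is right-handed if $\{\boldsymbol{e}_0,\boldsymbol{e}_1,\boldsymbol{e}_2,\boldsymbol{e}_3\}$ is positively oriented.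
   Formalization: The electric and magnetic 3-vectors (those measured by the wrench observer) are time-like only when non-zero, as one may vanish; the tetrad field is global but perhaps not smooth, with smooth tetrads near each point, up to reversing e_1, e_2 where the sign class of ψ differs. *)

theory Defs
  imports "HOL-Analysis.Analysis"
begin

section \<open>Smooth functions on open subsets of coordinate space\<close>

definition partial_deriv :: "4 \<Rightarrow> (real^4 \<Rightarrow> 'b::real_normed_vector) \<Rightarrow> real^4 \<Rightarrow> 'b" where
  "partial_deriv i f x = frechet_derivative f (at x) (axis i 1)"

primrec Ck_on :: "nat \<Rightarrow> (real^4) set \<Rightarrow> (real^4 \<Rightarrow> 'b::real_normed_vector) \<Rightarrow> bool" where
  "Ck_on 0 S f \<longleftrightarrow> continuous_on S f"
| "Ck_on (Suc k) S f \<longleftrightarrow> (\<forall>x\<in>S. f differentiable (at x)) \<and> (\<forall>i. Ck_on k S (partial_deriv i f))"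

text \<open>Only used for open \<open>S\<close>.\<close>
definition smooth_on :: "(real^4) set \<Rightarrow> (real^4 \<Rightarrow> 'b::real_normed_vector) \<Rightarrow> bool" where
  "smooth_on S f \<longleftrightarrow> (\<forall>k. Ck_on k S f)"


section \<open>Oriented smooth 4-manifolds and tensor fields\<close>

text \<open>The manifold is a whole type \<open>'m\<close> (Hausdorff and second countable). A chart is a pair of its
  domain and its coordinate map, and an oriented manifold is given by an atlas whose coordinate
  changes are smooth with positive Jacobian determinant, so every chart is positively oriented.\<close>

type_synonym 'm chart = "'m set \<times> ('m \<Rightarrow> real^4)"

definition chart_inv :: "'m chart \<Rightarrow> real^4 \<Rightarrow> 'm" where
  "chart_inv c = inv_into (fst c) (snd c)"

definition is_chart :: "'m::topological_space chart \<Rightarrow> bool" where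
  "is_chart c \<longleftrightarrow> open (fst c) \<and> open (snd c ` fst c) \<and>
     homeomorphism (fst c) (snd c ` fst c) (snd c) (chart_inv c)"

definition coord_change :: "'m chart \<Rightarrow> 'm chart \<Rightarrow> real^4 \<Rightarrow> real^4" where
  "coord_change c c' = snd c' \<circ> chart_inv c"

text \<open>\<open>jac c c' p $ i $ j\<close> is the derivative of the \<open>i\<close>-th coordinate of \<open>c'\<close> with respect to the
  \<open>j\<close>-th coordinate of \<open>c\<close>, at \<open>p\<close>.\<close>
definition jac :: "'m chart \<Rightarrow> 'm chart \<Rightarrow> 'm \<Rightarrow> real^4^4" where
  "jac c c' p = jacobian (coord_change c c') (at (snd c p))"

definition oriented_atlas :: "'m::topological_space chart set \<Rightarrow> bool" where
  "oriented_atlas A \<longleftrightarrow>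
     (\<forall>c\<in>A. is_chart c) \<and> (\<Union>c\<in>A. fst c) = UNIV \<and>
     (\<forall>c\<in>A. \<forall>c'\<in>A. smooth_on (snd c ` (fst c \<inter> fst c')) (coord_change c c') \<and>
        (\<forall>p \<in> fst c \<inter> fst c'. det (jac c c' p) > 0))"

text \<open>A field is the family of its component arrays in the charts of the atlas, subject to the
  transformation law under coordinate changes. \<open>V c p\<close> and \<open>G c p\<close> are meaningful only for
  \<open>p \<in> fst c\<close>, and \<open>G c p $ a $ b\<close> is the component with lower indices \<open>a\<close>, \<open>b\<close>.\<close>

type_synonym 'm vfield = "'m chart \<Rightarrow> 'm \<Rightarrow> real^4"
type_synonym 'm tfield = "'m chart \<Rightarrow> 'm \<Rightarrow> real^4^4"

definition vector_field_on :: "'m chart set \<Rightarrow> 'm set \<Rightarrow> 'm vfield \<Rightarrow> bool" where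
  "vector_field_on A U V \<longleftrightarrow>
     (\<forall>c\<in>A. \<forall>c'\<in>A. \<forall>p \<in> U \<inter> fst c \<inter> fst c'. V c' p = jac c c' p *v V c p)"

definition cov_tensor_field :: "'m chart set \<Rightarrow> 'm tfield \<Rightarrow> bool" where
  "cov_tensor_field A G \<longleftrightarrow>
     (\<forall>c\<in>A. \<forall>c'\<in>A. \<forall>p \<in> fst c \<inter> fst c'.
        G c p = transpose (jac c c' p) ** G c' p ** jac c c' p)"

definition smooth_field_on ::
    "'m chart set \<Rightarrow> 'm set \<Rightarrow> ('m chart \<Rightarrow> 'm \<Rightarrow> 'b::real_normed_vector) \<Rightarrow> bool" where
  "smooth_field_on A U f \<longleftrightarrow>
     (\<forall>c\<in>A. smooth_on (snd c ` (U \<inter> fst c)) (\<lambda>x. f c (chart_inv c x)))"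

definition two_form :: "'m chart set \<Rightarrow> 'm tfield \<Rightarrow> bool" where
  "two_form A G \<longleftrightarrow> cov_tensor_field A G \<and> smooth_field_on A UNIV G \<and>
     (\<forall>c\<in>A. \<forall>p \<in> fst c. \<forall>a b. G c p $ a $ b = - G c p $ b $ a)"

definition ext_deriv :: "'m tfield \<Rightarrow> 'm chart \<Rightarrow> 'm \<Rightarrow> 4 \<Rightarrow> 4 \<Rightarrow> 4 \<Rightarrow> real" where
  "ext_deriv G c p i j k =
     (let D = (\<lambda>i j k. partial_deriv i (\<lambda>x. G c (chart_inv c x) $ j $ k) (snd c p))
      in D i j k + D j k i + D k i j)"

definition closed_two_form :: "'m chart set \<Rightarrow> 'm tfield \<Rightarrow> bool" where
  "closed_two_form A G \<longleftrightarrow> (\<forall>c\<in>A. \<forall>p \<in> fst c. \<forall>i j k. ext_deriv G c p i j k = 0)"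


section \<open>Algebra of components at a point\<close>

definition ip :: "real^4^4 \<Rightarrow> real^4 \<Rightarrow> real^4 \<Rightarrow> real" where
  "ip h V W = (\<Sum>a\<in>UNIV. \<Sum>b\<in>UNIV. h $ a $ b * V $ a * W $ b)"

definition timelike :: "real^4^4 \<Rightarrow> real^4 \<Rightarrow> bool" where
  "timelike h V \<longleftrightarrow> ip h V V > 0"

definition spacelike :: "real^4^4 \<Rightarrow> real^4 \<Rightarrow> bool" where
  "spacelike h V \<longleftrightarrow> ip h V V < 0"

definition diag4 :: "real \<Rightarrow> real \<Rightarrow> real \<Rightarrow> real \<Rightarrow> real^4^4" where
  "diag4 d0 d1 d2 d3 =
     (\<chi> \<mu> \<nu>. if \<mu> \<noteq> \<nu> then 0
       else if \<mu> = 0 then d0 else if \<mu> = 1 then d1 else if \<mu> = 2 then d2 else d3)"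

definition lorentzian :: "real^4^4 \<Rightarrow> bool" where
  "lorentzian h \<longleftrightarrow> transpose h = h \<and>
     (\<exists>v :: 4 \<Rightarrow> real^4. \<forall>\<mu> \<nu>. ip h (v \<mu>) (v \<nu>) = diag4 1 (-1) (-1) (-1) $ \<mu> $ \<nu>)"

definition levi_civita :: "4 \<Rightarrow> 4 \<Rightarrow> 4 \<Rightarrow> 4 \<Rightarrow> real" where
  "levi_civita a b c d =
     (let p = (\<lambda>i::4. if i = 0 then a else if i = 1 then b else if i = 2 then c else d)
      in if p permutes UNIV then of_int (sign p) else 0)"

definition hodge :: "real^4^4 \<Rightarrow> real^4^4 \<Rightarrow> real^4^4" where
  "hodge h G = (\<chi> a b. 1 / 2 * sqrt (- det h) *
     (\<Sum>c\<in>UNIV. \<Sum>d\<in>UNIV. \<Sum>p\<in>UNIV. \<Sum>q\<in>UNIV.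
        levi_civita a b c d * matrix_inv h $ c $ p * matrix_inv h $ d $ q * G $ p $ q))"

definition form_ip :: "real^4^4 \<Rightarrow> real^4^4 \<Rightarrow> real^4^4 \<Rightarrow> real" where
  "form_ip h G H = 1 / 2 *
     (\<Sum>a\<in>UNIV. \<Sum>b\<in>UNIV. \<Sum>c\<in>UNIV. \<Sum>d\<in>UNIV.
        matrix_inv h $ a $ c * matrix_inv h $ b $ d * G $ a $ b * H $ c $ d)"

definition form_sq :: "real^4^4 \<Rightarrow> real^4^4 \<Rightarrow> real^4^4" where
  "form_sq h F = F ** matrix_inv h ** F"

definition psi :: "real^4^4 \<Rightarrow> real^4^4 \<Rightarrow> real" where
  "psi g F = form_ip g F F"

definition phi :: "real^4^4 \<Rightarrow> real^4^4 \<Rightarrow> real" where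
  "phi g F = form_ip g F (hodge g F)"

definition kappa :: "real^4^4 \<Rightarrow> real^4^4 \<Rightarrow> real" where
  "kappa g F = 1 / 2 * sqrt ((psi g F)\<^sup>2 + (phi g F)\<^sup>2)"

definition disformal :: "real^4^4 \<Rightarrow> real^4^4 \<Rightarrow> real^4^4" where
  "disformal g F = (- inverse (kappa g F)) *\<^sub>R (form_sq g F + (psi g F / 2) *\<^sub>R g)"

definition interior_mult :: "real^4 \<Rightarrow> real^4^4 \<Rightarrow> real^4" where
  "interior_mult V G = (\<chi> a. \<Sum>b\<in>UNIV. V $ b * G $ b $ a)"

definition flat :: "real^4^4 \<Rightarrow> real^4 \<Rightarrow> real^4" where
  "flat g V = (\<chi> a. \<Sum>b\<in>UNIV. g $ a $ b * V $ b)"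

definition electric :: "real^4^4 \<Rightarrow> real^4^4 \<Rightarrow> real^4 \<Rightarrow> real^4" where
  "electric g F X = (THE E. flat g E = - interior_mult X F)"

definition magnetic :: "real^4^4 \<Rightarrow> real^4^4 \<Rightarrow> real^4 \<Rightarrow> real^4" where
  "magnetic g F X = (THE B. flat g B = interior_mult X (hodge g F))"

text \<open>\<open>T\<close> is the value of the time-like vector field that fixes the time orientation: a time-like
  vector \<open>X\<close> lies in the same half of the light cone as \<open>T\<close> iff \<open>ip g X T > 0\<close>.\<close>
definition observer :: "real^4^4 \<Rightarrow> real^4 \<Rightarrow> real^4 \<Rightarrow> bool" where
  "observer g T X \<longleftrightarrow> ip g X X = 1 \<and> ip g X T > 0"

definition wrench_pair :: "real^4^4 \<Rightarrow> real^4 \<Rightarrow> real^4^4 \<Rightarrow> real^4 \<Rightarrow> real^4 \<Rightarrow> bool" where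
  "wrench_pair g T F X W \<longleftrightarrow> observer g T X \<and> ip g X W = 0 \<and> ip g W W = -1 \<and>
     (\<exists>\<alpha> \<beta>. electric g F X = \<alpha> *\<^sub>R W \<and> magnetic g F X = \<beta> *\<^sub>R W \<and>
        (psi g F \<le> 0 \<longrightarrow> \<alpha> > 0) \<and> (psi g F > 0 \<longrightarrow> \<beta> > 0))"

text \<open>Components are taken in a positively oriented chart.\<close>
definition right_handed_triad ::
    "real^4^4 \<Rightarrow> real^4 \<Rightarrow> real^4 \<Rightarrow> real^4 \<Rightarrow> real^4 \<Rightarrow> bool" where
  "right_handed_triad g X u v w \<longleftrightarrow>
     ip g X u = 0 \<and> ip g X v = 0 \<and> ip g X w = 0 \<and>
     det (\<chi> \<mu>::4. if \<mu> = 0 then X else if \<mu> = 1 then u else if \<mu> = 2 then v else w) > 0"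

text \<open>The zero vector is neither time-like nor space-like, and one of the two 3-vectors may vanish
  (for instance the magnetic one when \<open>F\<close> is purely electric), hence the guards in the last two
  clauses.\<close>
definition adapted_tetrad ::
    "real^4^4 \<Rightarrow> real^4 \<Rightarrow> real^4^4 \<Rightarrow> (4 \<Rightarrow> real^4) \<Rightarrow> bool" where
  "adapted_tetrad g T F e \<longleftrightarrow>
     (\<forall>\<mu> \<nu>. ip g (e \<mu>) (e \<nu>) = diag4 1 (-1) (-1) (-1) $ \<mu> $ \<nu>) \<and>
     (\<forall>\<mu> \<nu>. ip (disformal g F) (e \<mu>) (e \<nu>) = diag4 (-1) 1 (-1) (-1) $ \<mu> $ \<nu>) \<and>
     wrench_pair g T F (e 0) (e 1) \<and>
     right_handed_triad g (e 0) (e 1) (e 2) (e 3) \<and>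
     timelike (disformal g F) (e 1) \<and>
     spacelike (disformal g F) (e 0) \<and>
     (electric g F (e 0) \<noteq> 0 \<longrightarrow> timelike (disformal g F) (electric g F (e 0))) \<and>
     (magnetic g F (e 0) \<noteq> 0 \<longrightarrow> timelike (disformal g F) (magnetic g F (e 0)))"

text \<open>The sign of a wrench 3-vector is normalised through \<open>\<alpha>\<close> where \<open>psi \<le> 0\<close> and through \<open>\<beta>\<close> where
  \<open>psi > 0\<close>. If \<open>\<alpha>\<close> and \<open>\<beta>\<close> have opposite signs, the normalised vector therefore jumps to its
  negative where \<open>psi\<close> crosses zero, so no continuous tetrad satisfies the normalisation on both
  sides. A smooth local tetrad becomes normalised on the other side after the following reversal,
  which also reverses \<open>e 2\<close> to keep the triad right-handed.\<close>
definition reverse_wrench :: "(4 \<Rightarrow> real^4) \<Rightarrow> 4 \<Rightarrow> real^4" where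
  "reverse_wrench e = (\<lambda>\<mu>. if \<mu> = 1 \<or> \<mu> = 2 then - e \<mu> else e \<mu>)"


section \<open>Space-times and regular Maxwell fields\<close>

definition spacetime ::
    "'m::{t2_space,second_countable_topology} chart set \<Rightarrow> 'm tfield \<Rightarrow> 'm vfield \<Rightarrow> bool" where
  "spacetime A g T \<longleftrightarrow> oriented_atlas A \<and>
     cov_tensor_field A g \<and> smooth_field_on A UNIV g \<and>
     (\<forall>c\<in>A. \<forall>p \<in> fst c. lorentzian (g c p)) \<and>
     vector_field_on A UNIV T \<and> smooth_field_on A UNIV T \<and>
     (\<forall>c\<in>A. \<forall>p \<in> fst c. timelike (g c p) (T c p))"

definition maxwell_solution :: "'m chart set \<Rightarrow> 'm tfield \<Rightarrow> 'm tfield \<Rightarrow> bool" where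
  "maxwell_solution A g F \<longleftrightarrow>
     closed_two_form A F \<and> closed_two_form A (\<lambda>c p. hodge (g c p) (F c p))"

definition regular_form :: "'m chart set \<Rightarrow> 'm tfield \<Rightarrow> 'm tfield \<Rightarrow> bool" where
  "regular_form A g F \<longleftrightarrow> (\<forall>c\<in>A. \<forall>p \<in> fst c. kappa (g c p) (F c p) \<noteq> 0)"

end

theory Submission
  imports Defs
begin

text \<open>Write \<open>M = g\<inverse> F\<close>, so that the electric vector measured by \<open>X\<close> is \<open>M X\<close>. By Cayley-Hamilton,
  \<open>M\<^sup>4 + \<psi> M\<^sup>2 - \<phi>\<^sup>2/4 = 0\<close>, that is \<open>(M\<^sup>2 + \<kappa> + \<psi>/2) (M\<^sup>2 - (\<kappa> - \<psi>/2)) = 0\<close>. Hence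
  \<open>Y = (\<kappa> + \<psi>/2) T + M\<^sup>2 T\<close> satisfies \<open>M\<^sup>2 Y = (\<kappa> - \<psi>/2) Y\<close>, and \<open>g(Y,Y) = 2\<kappa> g(T,Y) > 0\<close> because
  \<open>g(T,Y)\<close> is an energy density. Normalising \<open>Y\<close> gives the observer \<open>X\<close>; where \<open>\<kappa> > \<psi>/2\<close>, the unit
  vector \<open>W = M X / sqrt (\<kappa> - \<psi>/2)\<close> satisfies \<open>F(X,\<cdot>) \<propto> g(W,\<cdot>)\<close> and \<open>F(W,\<cdot>) \<propto> g(X,\<cdot>)\<close>, so every
  oriented orthonormal completion of \<open>X, W\<close> brings \<open>F\<close> to the normal form \<open>F\<^sub>0\<^sub>1 = \<alpha>\<close>, \<open>F\<^sub>2\<^sub>3 = -\<beta>\<close>. Where \<open>\<psi> > 0\<close>, the same construction is applied to the dual form. All these formulas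
  are smooth in the point.\<close>

section \<open>Calculus of smooth functions\<close>

text \<open>In the normal form, psi = \<beta>^2 - \<alpha>^2 and phi = 2 \<alpha> \<beta>, hence
  \<alpha>^2 = kappa - psi/2 and \<beta>^2 = kappa + psi/2: this is where the two constants come
  from. The square of \<open>M\<close> is multiplication by \<alpha>^2 on the plane of
  \<open>X\<close>, \<open>W\<close> and by -\<beta>^2 on its orthogonal complement, so adding
  \<beta>^2 to it and applying the sum to \<open>T\<close> removes the component of \<open>T\<close>
  in the complement. Passing to the dual form exchanges \<alpha>^2 and \<beta>^2. The leg
  \<open>e 2\<close> has no such canonical formula. It is projected from a fixed coordinate vector,
  which works only near a point; smooth tetrads are therefore local, and the global one is chosen
  point by point. The sign convention adds a second obstacle: a tetrad built near a point with psi
  \<le> 0 keeps \<alpha> > 0 and may have to be reversed where psi > 0.\<close>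

lemma Ck_on_SucD:
  assumes "Ck_on (Suc k) S f" "x \<in> S"
  shows "(f has_derivative frechet_derivative f (at x)) (at x)"
  using assms frechet_derivative_works by auto

lemma Ck_on_frechet_derivative:
  "Ck_on (Suc k) S f \<Longrightarrow> Ck_on k S (\<lambda>x. frechet_derivative f (at x) (axis i 1))"
  by (simp add: partial_deriv_def[abs_def])

text \<open>On an open set a derivative at a point depends only on nearby values. Both functions are
  generalised in the induction because their partial derivatives take their place.\<close>

lemma Ck_on_cong:
  assumes "open S" "\<And>x. x \<in> S \<Longrightarrow> f x = g x" "Ck_on k S f"
  shows "Ck_on k S g"
  using assms(2,3)
proof (induction k arbitrary: f g)
  case 0
  then show ?case by (simp cong: continuous_on_cong)
next
  case (Suc k)
  have der: "(g has_derivative frechet_derivative f (at x)) (at x)" if "x \<in> S" for x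
    by (rule has_derivative_transform_within_open[OF Ck_on_SucD[OF Suc.prems(2) that] assms(1) that])
      (use Suc.prems(1) in auto)
  have eq: "partial_deriv i f x = partial_deriv i g x" if "x \<in> S" for i x
    unfolding partial_deriv_def using frechet_derivative_at[OF der[OF that]] by simp
  have "Ck_on k S (partial_deriv i g)" for i
    by (rule Suc.IH[of "partial_deriv i f"]) (use eq Suc.prems(2) in auto)
  moreover have "g differentiable (at x)" if "x \<in> S" for x
    using der[OF that] differentiableI by blast
  ultimately show ?case by simp
qed

text \<open>\<open>partial_deriv\<close> refers to a chosen derivative; by uniqueness any explicit
  formula \<open>D\<close> may replace it. The inductions below all supply such a formula.\<close>

lemma Ck_on_SucI:
  assumes "open S" "\<And>x. x \<in> S \<Longrightarrow> (f has_derivative D x) (at x)"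
    and "\<And>i. Ck_on k S (\<lambda>x. D x (axis i 1))"
  shows "Ck_on (Suc k) S f"
proof -
  have "Ck_on k S (partial_deriv i f)" for i
    by (rule Ck_on_cong[OF assms(1) _ assms(3)[of i]])
      (simp add: partial_deriv_def frechet_derivative_at[OF assms(2), symmetric])
  then show ?thesis using assms(2) by (auto intro: differentiableI)
qed

text \<open>Used where the product and chain rules leave a factor undifferentiated: that factor must
  be lowered by one order to meet the induction hypothesis.\<close>

lemma Ck_on_Suc_imp: "Ck_on (Suc k) S f \<Longrightarrow> Ck_on k S f"
proof (induction k arbitrary: f)
  case 0
  then show ?case
    by (auto intro!: continuous_at_imp_continuous_on differentiable_imp_continuous_within)
next
  case (Suc k)
  then show ?case by (metis Ck_on.simps(2))
qed

lemma Ck_on_subset: "Ck_on k S f \<Longrightarrow> S' \<subseteq> S \<Longrightarrow> Ck_on k S' f"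
  by (induction k arbitrary: f) (auto intro: continuous_on_subset)

lemma Ck_on_const: "open S \<Longrightarrow> Ck_on k S (\<lambda>x. c)"
proof (induction k arbitrary: c)
  case (Suc k)
  show ?case
    by (rule Ck_on_SucI[where D = "\<lambda>_ _. 0"]) (use Suc in \<open>auto intro!: derivative_eq_intros\<close>)
qed simp

lemma Ck_on_bounded_linear:
  assumes h: "bounded_linear h" and "open S" "Ck_on k S f"
  shows "Ck_on k S (\<lambda>x. h (f x))"
  using assms(3)
proof (induction k arbitrary: f)
  case 0
  then show ?case using h by (auto intro: linear_continuous_on_compose bounded_linear.continuous_on)
next
  case (Suc k)
  show ?case
  proof (rule Ck_on_SucI[OF assms(2)])
    show "((\<lambda>x. h (f x)) has_derivative (\<lambda>v. h (frechet_derivative f (at x) v))) (at x)"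
      if "x \<in> S" for x
      using bounded_linear.has_derivative[OF h Ck_on_SucD[OF Suc.prems that]] .
    show "Ck_on k S (\<lambda>x. h (frechet_derivative f (at x) (axis i 1)))" for i
      by (rule Suc.IH[OF Ck_on_frechet_derivative[OF Suc.prems]])
  qed
qed

lemma Ck_on_add:
  assumes "open S" "Ck_on k S f" "Ck_on k S g"
  shows "Ck_on k S (\<lambda>x. f x + g x)"
  using assms(2,3)
proof (induction k arbitrary: f g)
  case 0
  then show ?case by (auto intro: continuous_intros)
next
  case (Suc k)
  show ?case
  proof (rule Ck_on_SucI[OF assms(1)])
    show "((\<lambda>x. f x + g x) has_derivative
        (\<lambda>v. frechet_derivative f (at x) v + frechet_derivative g (at x) v)) (at x)"
      if "x \<in> S" for x
      using Ck_on_SucD[OF Suc.prems(1) that] Ck_on_SucD[OF Suc.prems(2) that]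
      by (rule has_derivative_add)
    show "Ck_on k S (\<lambda>x. frechet_derivative f (at x) (axis i 1)
        + frechet_derivative g (at x) (axis i 1))" for i
      by (intro Suc.IH Ck_on_frechet_derivative Suc.prems)
  qed
qed

lemma Ck_on_bounded_bilinear:
  assumes h: "bounded_bilinear h" and "open S" "Ck_on k S f" "Ck_on k S g"
  shows "Ck_on k S (\<lambda>x. h (f x) (g x))"
  using assms(3,4)
proof (induction k arbitrary: f g)
  case 0
  then show ?case using h by (auto intro: bounded_bilinear.continuous_on)
next
  case (Suc k)
  show ?case
  proof (rule Ck_on_SucI[OF assms(2)])
    show "((\<lambda>x. h (f x) (g x)) has_derivative
        (\<lambda>v. h (f x) (frechet_derivative g (at x) v) + h (frechet_derivative f (at x) v) (g x))) (at x)"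
      if "x \<in> S" for x
      using bounded_bilinear.FDERIV[OF h Ck_on_SucD[OF Suc.prems(1) that] Ck_on_SucD[OF Suc.prems(2) that]] .
    show "Ck_on k S (\<lambda>x. h (f x) (frechet_derivative g (at x) (axis i 1))
        + h (frechet_derivative f (at x) (axis i 1)) (g x))" for i
      by (intro Ck_on_add assms(2) Suc.IH Ck_on_frechet_derivative Suc.prems Ck_on_Suc_imp[OF Suc.prems(1)]
          Ck_on_Suc_imp[OF Suc.prems(2)])
  qed
qed

lemma Ck_on_sum:
  "open S \<Longrightarrow> (\<And>i. i \<in> I \<Longrightarrow> Ck_on k S (f i)) \<Longrightarrow> Ck_on k S (\<lambda>x. \<Sum>i\<in>I. f i x)"
  by (induction I rule: infinite_finite_induct) (auto intro: Ck_on_const Ck_on_add)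

text \<open>The chain rule as it stands is not of the form to which the induction hypothesis
  applies. Expanding the inner derivative in the standard basis turns it into a sum of products of
  partial derivatives of \<open>g\<close> with composites of partial derivatives of
  \<open>f\<close>.\<close>

lemma Ck_on_compose:
  fixes f :: "real^4 \<Rightarrow> 'b::real_normed_vector"
  assumes "open S" "g ` S \<subseteq> S'" "Ck_on k S' f" "Ck_on k S g"
  shows "Ck_on k S (\<lambda>x. f (g x))"
  using assms(3,4)
proof (induction k arbitrary: f)
  case 0
  then show ?case using assms(2) by (auto intro: continuous_on_compose2)
next
  case (Suc k)
  let ?D = "\<lambda>x v. frechet_derivative f (at (g x)) (frechet_derivative g (at x) v)"
  have lin: "linear (frechet_derivative f (at y))" if "y \<in> S'" for y
    using Ck_on_SucD[OF Suc.prems(1) that] has_derivative_linear by blast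
  have eq: "?D x (axis i 1) = (\<Sum>j\<in>UNIV. partial_deriv i g x $ j *\<^sub>R partial_deriv j f (g x))"
    if "x \<in> S" for x i
  proof -
    have "?D x (axis i 1)
        = frechet_derivative f (at (g x)) (\<Sum>j\<in>UNIV. partial_deriv i g x $ j *\<^sub>R axis j 1)"
      unfolding partial_deriv_def scalar_mult_eq_scaleR[symmetric] basis_expansion ..
    also have "\<dots> = (\<Sum>j\<in>UNIV. partial_deriv i g x $ j *\<^sub>R partial_deriv j f (g x))"
      unfolding partial_deriv_def using lin[of "g x"] that assms(2)
      by (subst linear_sum) (auto simp: linear_scale)
    finally show ?thesis .
  qed
  show ?case
  proof (rule Ck_on_SucI[OF assms(1)])
    show "((\<lambda>x. f (g x)) has_derivative ?D x) (at x)" if "x \<in> S" for x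
      using has_derivative_compose[OF Ck_on_SucD[OF Suc.prems(2) that] Ck_on_SucD[OF Suc.prems(1)]]
        that assms(2) by blast
    have "Ck_on k S (\<lambda>x. \<Sum>j\<in>UNIV. partial_deriv i g x $ j *\<^sub>R partial_deriv j f (g x))" for i
    proof (intro Ck_on_sum Ck_on_bounded_bilinear[OF bounded_bilinear_scaleR] assms(1))
      fix j :: 4
      show "Ck_on k S (\<lambda>x. partial_deriv i g x $ j)"
        using Suc.prems(2) by (intro Ck_on_bounded_linear[OF bounded_linear_vec_nth assms(1)]) auto
      show "Ck_on k S (\<lambda>x. partial_deriv j f (g x))"
        using Suc.prems Ck_on_Suc_imp[OF Suc.prems(2)] by (intro Suc.IH) auto
    qed
    then show "Ck_on k S (\<lambda>x. ?D x (axis i 1))" for i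
      by (rule Ck_on_cong[OF assms(1), rotated]) (simp add: eq)
  qed
qed

lemma Ck_on_mult:
  fixes f g :: "real^4 \<Rightarrow> real"
  shows "open S \<Longrightarrow> Ck_on k S f \<Longrightarrow> Ck_on k S g \<Longrightarrow> Ck_on k S (\<lambda>x. f x * g x)"
  by (rule Ck_on_bounded_bilinear[OF bounded_bilinear_mult])

text \<open>The derivative is a product of the derivative of \<open>f\<close> with two copies of the
  inverse itself, so the induction runs over \<open>k\<close> with \<open>f\<close> fixed. The
  square root is treated in the same way.\<close>

lemma Ck_on_inverse:
  fixes f :: "real^4 \<Rightarrow> real"
  assumes "open S" "\<And>x. x \<in> S \<Longrightarrow> f x \<noteq> 0" "Ck_on k S f"
  shows "Ck_on k S (\<lambda>x. inverse (f x))"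
  using assms(3)
proof (induction k)
  case 0
  then show ?case using assms(2) by (auto intro: continuous_intros)
next
  case (Suc k)
  show ?case
  proof (rule Ck_on_SucI[OF assms(1)])
    show "((\<lambda>x. inverse (f x)) has_derivative
        (\<lambda>v. - (inverse (f x) * frechet_derivative f (at x) v * inverse (f x)))) (at x)"
      if "x \<in> S" for x
      using Ck_on_SucD[OF Suc.prems that] assms(2)[OF that] by (intro Deriv.has_derivative_inverse) auto
    have "Ck_on k S (\<lambda>x. inverse (f x) * partial_deriv i f x * inverse (f x))" for i
      using Suc.prems Ck_on_Suc_imp[OF Suc.prems]
      by (intro Ck_on_mult assms(1) Suc.IH) auto
    then show "Ck_on k S (\<lambda>x. - (inverse (f x) * frechet_derivative f (at x) (axis i 1)
        * inverse (f x)))" for i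
      unfolding partial_deriv_def
      by (rule Ck_on_bounded_linear[OF bounded_linear_minus[OF bounded_linear_ident] assms(1)])
  qed
qed

lemma Ck_on_sqrt:
  assumes "open S" "\<And>x. x \<in> S \<Longrightarrow> f x > 0" "Ck_on k S f"
  shows "Ck_on k S (\<lambda>x. sqrt (f x))"
  using assms(3)
proof (induction k)
  case 0
  then show ?case by (auto intro: continuous_intros)
next
  case (Suc k)
  show ?case
  proof (rule Ck_on_SucI[OF assms(1)])
    show "((\<lambda>x. sqrt (f x)) has_derivative
        (\<lambda>v. frechet_derivative f (at x) v * (inverse (sqrt (f x)) / 2))) (at x)"
      if "x \<in> S" for x
      using has_derivative_real_sqrt[OF assms(2)[OF that] Ck_on_SucD[OF Suc.prems that]]
      by (simp add: divide_simps)
    have "Ck_on k S (\<lambda>x. inverse (sqrt (f x)))"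
    proof (rule Ck_on_inverse[OF assms(1)])
      show "sqrt (f x) \<noteq> 0" if "x \<in> S" for x using assms(2)[OF that] by simp
    qed (rule Suc.IH[OF Ck_on_Suc_imp[OF Suc.prems]])
    then have "Ck_on k S (\<lambda>x. partial_deriv i f x * (inverse (sqrt (f x)) * (1/2)))" for i
      using Suc.prems by (intro Ck_on_mult assms(1) Ck_on_const) auto
    then show "Ck_on k S (\<lambda>x. frechet_derivative f (at x) (axis i 1) * (inverse (sqrt (f x)) / 2))" for i
      by (simp add: partial_deriv_def)
  qed
qed

named_theorems smooth_intros

lemma smooth_on_cong:
  "open S \<Longrightarrow> (\<And>x. x \<in> S \<Longrightarrow> f x = g x) \<Longrightarrow> smooth_on S f \<Longrightarrow> smooth_on S g"
  unfolding smooth_on_def using Ck_on_cong by blast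

lemma smooth_on_subset: "smooth_on S f \<Longrightarrow> S' \<subseteq> S \<Longrightarrow> smooth_on S' f"
  unfolding smooth_on_def using Ck_on_subset by blast

lemma smooth_on_imp_continuous_on: "smooth_on S f \<Longrightarrow> continuous_on S f"
  unfolding smooth_on_def using Ck_on.simps(1) by blast

lemma smooth_on_imp_has_derivative:
  "smooth_on S f \<Longrightarrow> x \<in> S \<Longrightarrow> (f has_derivative frechet_derivative f (at x)) (at x)"
  unfolding smooth_on_def using Ck_on_SucD by blast

lemma smooth_on_partial_deriv: "smooth_on S f \<Longrightarrow> smooth_on S (partial_deriv i f)"
  unfolding smooth_on_def using Ck_on.simps(2) by blast

lemma smooth_on_const [smooth_intros]: "open S \<Longrightarrow> smooth_on S (\<lambda>x. c)"
  unfolding smooth_on_def by (blast intro: Ck_on_const)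

lemma smooth_on_add [smooth_intros]:
  "open S \<Longrightarrow> smooth_on S f \<Longrightarrow> smooth_on S g \<Longrightarrow> smooth_on S (\<lambda>x. f x + g x)"
  unfolding smooth_on_def by (blast intro: Ck_on_add)

lemma smooth_on_bounded_linear:
  "bounded_linear h \<Longrightarrow> open S \<Longrightarrow> smooth_on S f \<Longrightarrow> smooth_on S (\<lambda>x. h (f x))"
  unfolding smooth_on_def by (blast intro: Ck_on_bounded_linear)

lemma smooth_on_minus [smooth_intros]:
  "open S \<Longrightarrow> smooth_on S f \<Longrightarrow> smooth_on S (\<lambda>x. - f x)"
  by (rule smooth_on_bounded_linear[OF bounded_linear_minus[OF bounded_linear_ident]])

lemma smooth_on_diff [smooth_intros]:
  "open S \<Longrightarrow> smooth_on S f \<Longrightarrow> smooth_on S g \<Longrightarrow> smooth_on S (\<lambda>x. f x - g x)"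
  using smooth_on_add[of S f "\<lambda>x. - g x"] smooth_on_minus[of S g] by simp

lemma smooth_on_mult [smooth_intros]:
  fixes f g :: "real^4 \<Rightarrow> real"
  shows "open S \<Longrightarrow> smooth_on S f \<Longrightarrow> smooth_on S g \<Longrightarrow> smooth_on S (\<lambda>x. f x * g x)"
  unfolding smooth_on_def by (blast intro: Ck_on_mult)

lemma smooth_on_scaleR [smooth_intros]:
  "open S \<Longrightarrow> smooth_on S f \<Longrightarrow> smooth_on S g \<Longrightarrow> smooth_on S (\<lambda>x. f x *\<^sub>R g x)"
  unfolding smooth_on_def by (blast intro: Ck_on_bounded_bilinear[OF bounded_bilinear_scaleR])

lemma smooth_on_sum [smooth_intros]:
  "open S \<Longrightarrow> (\<And>i. i \<in> I \<Longrightarrow> smooth_on S (f i)) \<Longrightarrow> smooth_on S (\<lambda>x. \<Sum>i\<in>I. f i x)"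
  unfolding smooth_on_def by (blast intro: Ck_on_sum)

lemma smooth_on_prod [smooth_intros]:
  fixes f :: "'i \<Rightarrow> real^4 \<Rightarrow> real"
  shows "open S \<Longrightarrow> (\<And>i. i \<in> I \<Longrightarrow> smooth_on S (f i)) \<Longrightarrow> smooth_on S (\<lambda>x. \<Prod>i\<in>I. f i x)"
  by (induction I rule: infinite_finite_induct) (auto intro: smooth_intros)

lemma smooth_on_compose:
  "open S \<Longrightarrow> g ` S \<subseteq> S' \<Longrightarrow> smooth_on S' f \<Longrightarrow> smooth_on S g \<Longrightarrow> smooth_on S (\<lambda>x. f (g x))"
  unfolding smooth_on_def by (blast intro: Ck_on_compose)

lemma smooth_on_inverse:
  fixes f :: "real^4 \<Rightarrow> real"
  shows "open S \<Longrightarrow> (\<And>x. x \<in> S \<Longrightarrow> f x \<noteq> 0) \<Longrightarrow> smooth_on S f \<Longrightarrow> smooth_on S (\<lambda>x. inverse (f x))"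
  unfolding smooth_on_def by (blast intro: Ck_on_inverse)

lemma smooth_on_divide:
  fixes f g :: "real^4 \<Rightarrow> real"
  shows "open S \<Longrightarrow> (\<And>x. x \<in> S \<Longrightarrow> g x \<noteq> 0) \<Longrightarrow> smooth_on S f \<Longrightarrow> smooth_on S g \<Longrightarrow>
    smooth_on S (\<lambda>x. f x / g x)"
  unfolding divide_inverse by (intro smooth_on_mult smooth_on_inverse)

lemma smooth_on_sqrt:
  "open S \<Longrightarrow> (\<And>x. x \<in> S \<Longrightarrow> f x > 0) \<Longrightarrow> smooth_on S f \<Longrightarrow> smooth_on S (\<lambda>x. sqrt (f x))"
  unfolding smooth_on_def by (blast intro: Ck_on_sqrt)

lemma smooth_on_vec_nth [smooth_intros]:
  fixes f :: "real^4 \<Rightarrow> ('b::real_normed_vector)^'n"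
  shows "open S \<Longrightarrow> smooth_on S f \<Longrightarrow> smooth_on S (\<lambda>x. f x $ i)"
  by (rule smooth_on_bounded_linear[OF bounded_linear_vec_nth])

lemma smooth_on_vec_lambda [smooth_intros]:
  fixes f :: "real^4 \<Rightarrow> 'n::finite \<Rightarrow> 'b::euclidean_space"
  assumes "open S" "\<And>i. smooth_on S (\<lambda>x. f x i)"
  shows "smooth_on S (\<lambda>x. \<chi> i. f x i)"
proof -
  have lin: "bounded_linear (axis i :: 'b \<Rightarrow> 'b^'n)" for i
    unfolding linear_conv_bounded_linear[symmetric]
    by (rule linearI) (auto simp: axis_def vec_eq_iff)
  have "(\<chi> i. f x i) = (\<Sum>i\<in>UNIV. axis i (f x i))" for x
    by (simp add: vec_eq_iff axis_def if_distrib[where f="\<lambda>h. h $ _"] sum.delta cong: if_cong)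
  then show ?thesis
    using assms by (auto intro!: smooth_on_sum smooth_on_bounded_linear[OF lin])
qed

lemma smooth_on_det [smooth_intros]:
  fixes f :: "real^4 \<Rightarrow> real^'n^'n"
  shows "open S \<Longrightarrow> smooth_on S f \<Longrightarrow> smooth_on S (\<lambda>x. det (f x))"
  unfolding det_def by (intro smooth_intros) auto

lemma smooth_on_matrix_vector_mult [smooth_intros]:
  fixes f :: "real^4 \<Rightarrow> real^'n^'k"
  shows "open S \<Longrightarrow> smooth_on S f \<Longrightarrow> smooth_on S g \<Longrightarrow> smooth_on S (\<lambda>x. f x *v g x)"
  unfolding matrix_vector_mult_def by (intro smooth_intros)

section \<open>Inverse matrices and Cramer's rule\<close>

lemma
  fixes B :: "real^'n^'n"
  assumes "det B \<noteq> 0"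
  shows matrix_inv_right: "B ** matrix_inv B = mat 1"
    and matrix_inv_left: "matrix_inv B ** B = mat 1"
proof -
  have "\<exists>C. B ** C = mat 1 \<and> C ** B = mat 1"
    using assms invertible_det_nz invertible_def by blast
  from someI_ex[OF this] show "B ** matrix_inv B = mat 1" "matrix_inv B ** B = mat 1"
    unfolding matrix_inv_def by auto
qed

text \<open>Cramer's rule applied to the columns of the identity. It replaces the chosen inverse by
  quotients of determinants, whose smooth dependence is already known.\<close>

lemma matrix_inv_nth:
  fixes B :: "real^'n^'n"
  assumes "det B \<noteq> 0"
  shows "matrix_inv B $ k $ l = det (\<chi> i j. if j = k then axis l 1 $ i else B $ i $ j) / det B"
proof -
  have "B *v (matrix_inv B *v axis l 1) = axis l 1"
    by (simp add: matrix_vector_mul_assoc matrix_inv_right[OF assms])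
  then have "matrix_inv B *v axis l 1
      = (\<chi> k. det (\<chi> i j. if j = k then axis l 1 $ i else B $ i $ j) / det B)"
    using cramer[OF assms] by blast
  moreover have "matrix_inv B $ k $ l = (matrix_inv B *v axis l 1) $ k"
    by (simp add: matrix_vector_mult_basis column_def)
  ultimately show ?thesis by simp
qed

lemma smooth_on_matrix_inv:
  fixes f :: "real^4 \<Rightarrow> real^'n^'n"
  assumes "open S" "\<And>x. x \<in> S \<Longrightarrow> det (f x) \<noteq> 0" "smooth_on S f"
  shows "smooth_on S (\<lambda>x. matrix_inv (f x))"
proof (rule smooth_on_cong[OF assms(1)])
  show "(\<chi> k l. det (\<chi> i j. if j = k then axis l 1 $ i else f x $ i $ j) / det (f x))
      = matrix_inv (f x)" if "x \<in> S" for x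
    using matrix_inv_nth[OF assms(2)[OF that]] by (simp add: vec_eq_iff)
  have *: "smooth_on S (\<lambda>x. if j = k then axis l 1 $ i else f x $ i $ j)" for i j k l :: 'n
    by (cases "j = k") (auto intro!: smooth_intros assms)
  show "smooth_on S
      (\<lambda>x. \<chi> k l. det (\<chi> i j. if j = k then axis l 1 $ i else f x $ i $ j) / det (f x))"
    by (intro smooth_intros smooth_on_divide assms *)
qed

section \<open>Determinants and the Levi-Civita symbol\<close>

text \<open>The index type is arithmetic modulo 4. The library enumerates it as 1, 2, 3, 4, whereas
  space-time indices run over 0, 1, 2, 3.\<close>

lemma four_eq_zero: "(4::4) = 0"
  using exhaust_4[of 0] by auto

lemma sum_UNIV_4: "sum f (UNIV::4 set) = f 0 + f 1 + f 2 + f 3"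
  unfolding sum_4 four_eq_zero by (simp add: ac_simps)

lemma all_4: "(\<forall>i::4. P i) \<longleftrightarrow> P 0 \<and> P 1 \<and> P 2 \<and> P 3"
  unfolding forall_4 four_eq_zero by blast

abbreviation rows4 :: "real^4 \<Rightarrow> real^4 \<Rightarrow> real^4 \<Rightarrow> real^4 \<Rightarrow> real^4^4" where
  "rows4 x y z w \<equiv> \<chi> \<mu>. if \<mu> = 0 then x else if \<mu> = 1 then y else if \<mu> = 2 then z else w"

lemma det_4: "det (A::real^4^4) =
  A$0$0 * A$1$1 * A$2$2 * A$3$3 - A$0$0 * A$1$1 * A$2$3 * A$3$2
 - A$0$0 * A$1$2 * A$2$1 * A$3$3 + A$0$0 * A$1$2 * A$2$3 * A$3$1
 + A$0$0 * A$1$3 * A$2$1 * A$3$2 - A$0$0 * A$1$3 * A$2$2 * A$3$1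
 - A$0$1 * A$1$0 * A$2$2 * A$3$3 + A$0$1 * A$1$0 * A$2$3 * A$3$2
 + A$0$1 * A$1$2 * A$2$0 * A$3$3 - A$0$1 * A$1$2 * A$2$3 * A$3$0
 - A$0$1 * A$1$3 * A$2$0 * A$3$2 + A$0$1 * A$1$3 * A$2$2 * A$3$0
 + A$0$2 * A$1$0 * A$2$1 * A$3$3 - A$0$2 * A$1$0 * A$2$3 * A$3$1
 - A$0$2 * A$1$1 * A$2$0 * A$3$3 + A$0$2 * A$1$1 * A$2$3 * A$3$0
 + A$0$2 * A$1$3 * A$2$0 * A$3$1 - A$0$2 * A$1$3 * A$2$1 * A$3$0
 - A$0$3 * A$1$0 * A$2$1 * A$3$2 + A$0$3 * A$1$0 * A$2$2 * A$3$1
 + A$0$3 * A$1$1 * A$2$0 * A$3$2 - A$0$3 * A$1$1 * A$2$2 * A$3$0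
 - A$0$3 * A$1$2 * A$2$0 * A$3$1 + A$0$3 * A$1$2 * A$2$1 * A$3$0"
proof -
  have UNIV_eq: "(UNIV::4 set) = {0, 1, 2, 3}" unfolding UNIV_4 four_eq_zero by auto
  have fi: "finite {1::4, 2, 3}" "0 \<notin> {1::4, 2, 3}" "finite {2::4, 3}" "1 \<notin> {2::4, 3}"
    "finite {3::4}" "2 \<notin> {3::4}" by auto
  show ?thesis
    unfolding det_def UNIV_eq
    unfolding sum_over_permutations_insert[OF fi(1,2)]
    unfolding sum_over_permutations_insert[OF fi(3,4)]
    unfolding sum_over_permutations_insert[OF fi(5,6)]
    unfolding permutes_sing
    by (simp add: sign_swap_id sign_compose permutation_swap_id permutation_compose sign_id transpose_apply_other transpose_def)
qed

lemma det_axes: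
  "det (\<chi> i. axis (p i) 1 :: real^'n^'n) = (if p permutes UNIV then of_int (sign p) else 0)"
proof (cases "p permutes UNIV")
  case True
  have "(\<chi> i. axis (p i) 1 :: real^'n^'n) = (\<chi> i. (mat 1 :: real^'n^'n) $ p i)"
    by (auto simp: vec_eq_iff axis_def mat_def)
  then show ?thesis using True det_permute_rows[of p "mat 1 :: real^'n^'n"] by simp
next
  case False
  then have "\<not> inj p"
    using finite_UNIV_inj_surj[of p] bij_imp_permutes[of p UNIV] by (auto simp: bij_def)
  then obtain i j where ij: "i \<noteq> j" "p i = p j" by (auto simp: inj_def)
  show ?thesis using False ij
    by (auto intro!: det_identical_rows[of i j] simp: row_def)
qed

text \<open>Once the symbol is a determinant, its contractions follow from multilinearity and
  multiplicativity of \<open>det\<close> instead of manipulations of permutations.\<close>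

lemma levi_civita_eq_det:
  "levi_civita a b c d = det (rows4 (axis a 1) (axis b 1) (axis c 1) (axis d 1))"
proof -
  let ?p = "\<lambda>i::4. if i = 0 then a else if i = 1 then b else if i = 2 then c else d"
  have "rows4 (axis a 1) (axis b 1) (axis c 1) (axis d 1) = (\<chi> i. axis (?p i) 1)"
    by (simp add: vec_eq_iff)
  then show ?thesis unfolding levi_civita_def Let_def using det_axes[of ?p] by simp
qed

lemma det_row_expand:
  fixes x :: "real^'n"
  shows "det (\<chi> i. if i = k then x else c i) = (\<Sum>a\<in>UNIV. x $ a * det (\<chi> i. if i = k then axis a 1 else c i))"
proof -
  have "det (\<chi> i. if i = k then x else c i)
      = det (\<chi> i. if i = k then (\<Sum>a\<in>UNIV. x $ a *s axis a 1) else c i)"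
    unfolding basis_expansion ..
  also have "\<dots> = (\<Sum>a\<in>UNIV. det (\<chi> i. if i = k then x $ a *s axis a 1 else c i))"
    using det_linear_row_sum[of UNIV k "\<lambda>i a. x $ a *s axis a 1" c] by simp
  also have "\<dots> = (\<Sum>a\<in>UNIV. x $ a * det (\<chi> i. if i = k then axis a 1 else c i))"
    by (intro sum.cong refl det_row_mul)
  finally show ?thesis .
qed

lemma det_rows4_expand:
  "det (rows4 x y z w) = (\<Sum>a\<in>UNIV. x $ a * det (rows4 (axis a 1) y z w))"
  "det (rows4 x y z w) = (\<Sum>a\<in>UNIV. y $ a * det (rows4 x (axis a 1) z w))"
  "det (rows4 x y z w) = (\<Sum>a\<in>UNIV. z $ a * det (rows4 x y (axis a 1) w))"
  "det (rows4 x y z w) = (\<Sum>a\<in>UNIV. w $ a * det (rows4 x y z (axis a 1)))"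
proof -
  \<comment> \<open>The nested conditional is rearranged so that the row to be expanded is tested
    first, as \<open>det_row_expand\<close> requires.\<close>
  have 1: "rows4 x y z w = (\<chi> \<mu>. if \<mu> = 1 then y else if \<mu> = 0 then x else if \<mu> = 2 then z else w)"
    and 2: "rows4 x y z w = (\<chi> \<mu>. if \<mu> = 2 then z else if \<mu> = 0 then x else if \<mu> = 1 then y else w)"
    and 3: "rows4 x y z w = (\<chi> \<mu>. if \<mu> = 3 then w else if \<mu> = 0 then x else if \<mu> = 1 then y else z)"
    for x y z w :: "real^4"
    by (simp_all add: vec_eq_iff all_4)
  show "det (rows4 x y z w) = (\<Sum>a\<in>UNIV. x $ a * det (rows4 (axis a 1) y z w))"
    by (rule det_row_expand)
  show "det (rows4 x y z w) = (\<Sum>a\<in>UNIV. y $ a * det (rows4 x (axis a 1) z w))"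
    unfolding 1 by (rule det_row_expand)
  show "det (rows4 x y z w) = (\<Sum>a\<in>UNIV. z $ a * det (rows4 x y (axis a 1) w))"
    unfolding 2 by (rule det_row_expand)
  show "det (rows4 x y z w) = (\<Sum>a\<in>UNIV. w $ a * det (rows4 x y z (axis a 1)))"
    unfolding 3 by (rule det_row_expand)
qed

lemma levi_civita_sum:
  "(\<Sum>a\<in>UNIV. \<Sum>b\<in>UNIV. \<Sum>c\<in>UNIV. \<Sum>d\<in>UNIV. x $ a * y $ b * z $ c * w $ d * levi_civita a b c d)
    = det (rows4 x y z w)"
proof -
  have "det (rows4 x y z w) = (\<Sum>a\<in>UNIV. x $ a * (\<Sum>b\<in>UNIV. y $ b *
    (\<Sum>c\<in>UNIV. z $ c * (\<Sum>d\<in>UNIV. w $ d * levi_civita a b c d))))"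
    unfolding levi_civita_eq_det by (simp flip: det_rows4_expand)
  then show ?thesis by (simp add: sum_distrib_left mult.assoc)
qed

section \<open>Change of frame\<close>

text \<open>If the rows of \<open>L\<close> are the vectors of a frame, then \<open>congr L G\<close> is the matrix of the components
  of the covariant 2-tensor \<open>G\<close> in that frame.\<close>
definition congr :: "real^'n^'n \<Rightarrow> real^'n^'n \<Rightarrow> real^'n^'n" where
  "congr L G = L ** G ** transpose L"

abbreviation minkowski :: "real^4^4" where
  "minkowski \<equiv> diag4 1 (-1) (-1) (-1)"

lemma ip_eq_inner: "ip h V W = V \<bullet> (h *v W)"
  by (simp add: ip_def inner_vec_def matrix_vector_mult_def sum_distrib_left mult_ac)

lemma congr_nth: "congr P h $ \<mu> $ \<nu> = ip h (P $ \<mu>) (P $ \<nu>)"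
proof -
  have "congr P h $ \<mu> $ \<nu> = (\<Sum>b\<in>UNIV. \<Sum>a\<in>UNIV. h $ a $ b * P $ \<mu> $ a * P $ \<nu> $ b)"
    by (simp add: congr_def matrix_matrix_mult_def transpose_def sum_distrib_left sum_distrib_right mult_ac)
  also have "\<dots> = ip h (P $ \<mu>) (P $ \<nu>)"
    unfolding ip_def by (rule sum.swap)
  finally show ?thesis .
qed

lemma det_congr: "det (congr L G) = (det L)\<^sup>2 * det G"
  by (simp add: congr_def det_mul det_transpose power2_eq_square)

lemma congr_congr: "congr L (congr L' G) = congr (L ** L') G"
  by (simp add: congr_def matrix_transpose_mul matrix_mul_assoc)

lemma transpose_congr: "transpose (congr L G) = congr L (transpose G)"
  by (simp add: congr_def matrix_transpose_mul matrix_mul_assoc)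

lemma matrix_inv_unique: "A ** B = mat 1 \<Longrightarrow> matrix_inv A = (B::real^'n^'n)"
  by (metis det_I det_mul matrix_inv_left matrix_mul_assoc matrix_mul_lid matrix_mul_rid mult_zero_left zero_neq_one)

lemma matrix_inv_congr:
  assumes "det L \<noteq> 0" "det G \<noteq> 0"
  shows "matrix_inv (congr L G) = transpose (matrix_inv L) ** matrix_inv G ** matrix_inv L"
proof (rule matrix_inv_unique)
  have "transpose L ** transpose (matrix_inv L) = mat 1"
    by (metis assms(1) matrix_inv_left matrix_transpose_mul transpose_mat)
  then show "congr L G ** (transpose (matrix_inv L) ** matrix_inv G ** matrix_inv L) = mat 1"
    unfolding congr_def
    by (metis assms matrix_inv_right matrix_mul_assoc matrix_mul_rid)
qed

text \<open>Raising an index turns congruence into similarity: \<open>M\<close> is conjugated by the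
  coordinate change \<open>transpose L\<close>. Polynomial identities for \<open>M\<close> can
  therefore be checked in one frame.\<close>

lemma raise_congr:
  assumes "det L \<noteq> 0" "det G \<noteq> 0"
  shows "matrix_inv (congr L G) ** congr L F = transpose (matrix_inv L) ** (matrix_inv G ** F) ** transpose L"
  unfolding matrix_inv_congr[OF assms] unfolding congr_def
  by (metis assms matrix_inv_left matrix_mul_assoc matrix_mul_rid)

text \<open>Rebuilds the inverse metric from its frame components; for an orthonormal frame it is
  the signed sum of the tensor squares of the frame vectors.\<close>

lemma matrix_inv_congr_back:
  assumes "det L \<noteq> 0" "det G \<noteq> 0"
  shows "matrix_inv G = congr (transpose L) (matrix_inv (congr L G))"
proof -
  have 1: "transpose L ** transpose (matrix_inv L) = mat 1"
    by (metis assms(1) matrix_inv_left matrix_transpose_mul transpose_mat)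
  have 2: "matrix_inv L ** L = mat 1" by (rule matrix_inv_left[OF assms(1)])
  have "congr (transpose L) (matrix_inv (congr L G))
     = (transpose L ** transpose (matrix_inv L)) ** matrix_inv G ** (matrix_inv L ** L)"
    unfolding matrix_inv_congr[OF assms] unfolding congr_def by (simp add: matrix_mul_assoc)
  then show ?thesis by (simp add: 1 2)
qed

lemma sum_swap_inner:
  "(\<Sum>a\<in>A. \<Sum>c\<in>C. \<Sum>d\<in>D. f a c d) = (\<Sum>c\<in>C. \<Sum>d\<in>D. \<Sum>a\<in>A. f a c d)"
  by (rule trans[OF sum.swap sum.cong[OF refl sum.swap]])

text \<open>In this shape, frame independence becomes cyclicity of the trace.\<close>

lemma form_ip_eq_trace: "form_ip h G H = 1/2 * trace (transpose (matrix_inv h) ** G ** matrix_inv h ** transpose H)"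
proof -
  let ?f = "\<lambda>a b c d. matrix_inv h $ a $ c * matrix_inv h $ b $ d * G $ a $ b * H $ c $ d"
  have "trace (transpose (matrix_inv h) ** G ** matrix_inv h ** transpose H)
    = (\<Sum>c\<in>UNIV. \<Sum>d\<in>UNIV. \<Sum>b\<in>UNIV. \<Sum>a\<in>UNIV. ?f a b c d)"
    by (simp add: trace_def matrix_matrix_mult_def transpose_def sum_distrib_left sum_distrib_right mult_ac)
  also have "\<dots> = (\<Sum>b\<in>UNIV. \<Sum>a\<in>UNIV. \<Sum>c\<in>UNIV. \<Sum>d\<in>UNIV. ?f a b c d)"
    by (rule trans[OF sum.cong[OF refl sum_swap_inner] sum_swap_inner])
  also have "\<dots> = (\<Sum>a\<in>UNIV. \<Sum>b\<in>UNIV. \<Sum>c\<in>UNIV. \<Sum>d\<in>UNIV. ?f a b c d)"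
    by (rule sum.swap)
  finally show ?thesis unfolding form_ip_def by simp
qed

lemma form_ip_congr:
  assumes "det L \<noteq> 0" "det g \<noteq> 0"
  shows "form_ip (congr L g) (congr L G) (congr L H) = form_ip g G H"
proof -
  let ?K = "matrix_inv L" and ?gi = "matrix_inv g"
  have KL: "?K ** L = mat 1" by (rule matrix_inv_left[OF assms(1)])
  have LK: "transpose L ** transpose ?K = mat 1"
    by (metis assms(1) matrix_inv_left matrix_transpose_mul transpose_mat)
  have "transpose (matrix_inv (congr L g)) ** congr L G ** matrix_inv (congr L g) ** transpose (congr L H)
    = transpose ?K ** transpose ?gi ** (?K ** L) ** G ** (transpose L ** transpose ?K) ** ?gi ** (?K ** L)
        ** transpose H ** transpose L"
    unfolding matrix_inv_congr[OF assms] unfolding congr_def matrix_transpose_mul transpose_transpose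
    by (simp add: matrix_mul_assoc)
  also have "\<dots> = transpose ?K ** (transpose ?gi ** G ** ?gi ** transpose H ** transpose L)"
    by (simp add: KL LK matrix_mul_assoc)
  finally have "trace (transpose (matrix_inv (congr L g)) ** congr L G ** matrix_inv (congr L g) ** transpose (congr L H))
    = trace (transpose ?K ** (transpose ?gi ** G ** ?gi ** transpose H ** transpose L))" by simp
  \<comment> \<open>Cyclicity brings the leftover \<open>transpose ?K\<close> next to
    \<open>transpose L\<close>, where they cancel.\<close>
  also have "\<dots> = trace ((transpose ?gi ** G ** ?gi ** transpose H ** transpose L) ** transpose ?K)"
    by (rule trace_mul_sym)
  also have "\<dots> = trace ((transpose ?gi ** G ** ?gi ** transpose H) ** (transpose L ** transpose ?K))"
    by (simp add: matrix_mul_assoc)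
  finally show ?thesis by (simp add: form_ip_eq_trace LK)
qed

lemma psi_congr: "det L \<noteq> 0 \<Longrightarrow> det g \<noteq> 0 \<Longrightarrow> psi (congr L g) (congr L F) = psi g F"
  by (simp add: psi_def form_ip_congr)

text \<open>The symbol is a tensor density: the selected rows of \<open>L\<close> are rows of basis
  vectors multiplied by \<open>L\<close>, and \<open>det_mul\<close> splits off the factor
  \<open>det L\<close>.\<close>

lemma levi_civita_congr:
  "(\<Sum>a\<in>UNIV. \<Sum>b\<in>UNIV. \<Sum>c\<in>UNIV. \<Sum>d\<in>UNIV. L $ \<alpha> $ a * L $ \<beta> $ b * L $ \<gamma> $ c * L $ \<delta> $ d * levi_civita a b c d)
    = det L * levi_civita \<alpha> \<beta> \<gamma> \<delta>"
proof -
  have "rows4 (L $ \<alpha>) (L $ \<beta>) (L $ \<gamma>) (L $ \<delta>)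
      = rows4 (axis \<alpha> 1) (axis \<beta> 1) (axis \<gamma> 1) (axis \<delta> 1) ** L"
    by (simp add: vec_eq_iff matrix_matrix_mult_def axis_def if_distrib[where f="\<lambda>x. x * _"]
        sum.delta cong: if_cong)
  then show ?thesis
    unfolding levi_civita_sum by (simp add: det_mul levi_civita_eq_det)
qed

lemma hodge_nth: "hodge h G $ a $ b = 1/2 * sqrt (- det h) *
  (\<Sum>c\<in>UNIV. \<Sum>d\<in>UNIV. levi_civita a b c d * (matrix_inv h ** G ** transpose (matrix_inv h)) $ c $ d)"
proof -
  have "(matrix_inv h ** G ** transpose (matrix_inv h)) $ c $ d
     = (\<Sum>p\<in>UNIV. \<Sum>q\<in>UNIV. matrix_inv h $ c $ p * matrix_inv h $ d $ q * G $ p $ q)" for c d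
    unfolding matrix_matrix_mult_def transpose_def
    by (simp add: sum_distrib_left sum_distrib_right mult_ac) (rule sum.swap)
  then show ?thesis by (simp add: hodge_def sum_distrib_left mult_ac)
qed

text \<open>The symbol contributes \<open>det L\<close> and the volume factor contributes its
  absolute value. What remains is the sign, so the Hodge dual is a tensor under
  orientation-preserving changes of frame.\<close>

lemma hodge_congr:
  assumes "det L \<noteq> 0" "det g \<noteq> 0"
  shows "congr L (hodge g F) = sgn (det L) *\<^sub>R hodge (congr L g) (congr L F)"
proof -
  let ?R = "matrix_inv g ** F ** transpose (matrix_inv g)"
  define R' where "R' = matrix_inv (congr L g) ** congr L F ** transpose (matrix_inv (congr L g))"
  let ?K = "matrix_inv L"
  have LK: "transpose L ** transpose ?K = mat 1"
    by (metis assms(1) matrix_inv_left matrix_transpose_mul transpose_mat)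
  have KL: "?K ** L = mat 1" by (rule matrix_inv_left[OF assms(1)])
  have "congr (transpose L) R' = (transpose L ** transpose ?K) ** matrix_inv g ** (?K ** L) ** F **
     (transpose L ** transpose ?K) ** transpose (matrix_inv g) ** (?K ** L)"
    unfolding R'_def matrix_inv_congr[OF assms] unfolding congr_def matrix_transpose_mul transpose_transpose
    by (simp add: matrix_mul_assoc)
  then have R: "?R = congr (transpose L) R'"
    by (simp add: KL LK)
  have Rn: "?R $ c $ d = (\<Sum>\<gamma>\<in>UNIV. \<Sum>\<delta>\<in>UNIV. L $ \<gamma> $ c * L $ \<delta> $ d * R' $ \<gamma> $ \<delta>)" for c d
    unfolding R congr_nth ip_def by (simp add: transpose_def mult_ac)
  show ?thesis
  proof (simp only: vec_eq_iff, intro allI)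
    fix \<alpha> \<beta>
    let ?f = "\<lambda>a b c d \<gamma> \<delta>. L $ \<alpha> $ a * L $ \<beta> $ b * L $ \<gamma> $ c * L $ \<delta> $ d * levi_civita a b c d * R' $ \<gamma> $ \<delta>"
    have "congr L (hodge g F) $ \<alpha> $ \<beta> = (\<Sum>a\<in>UNIV. \<Sum>b\<in>UNIV. hodge g F $ a $ b * L $ \<alpha> $ a * L $ \<beta> $ b)"
      by (simp add: congr_nth ip_def)
    also have "\<dots> = 1/2 * sqrt (- det g) * (\<Sum>a\<in>UNIV. \<Sum>b\<in>UNIV. \<Sum>c\<in>UNIV. \<Sum>d\<in>UNIV. \<Sum>\<gamma>\<in>UNIV. \<Sum>\<delta>\<in>UNIV. ?f a b c d \<gamma> \<delta>)"
      unfolding hodge_nth Rn by (simp add: sum_distrib_left sum_distrib_right mult_ac)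
    \<comment> \<open>The frame sums over \<open>\<gamma>\<close> and \<open>\<delta>\<close> move
      outwards past one sum at a time, until the four inner sums are those of
      \<open>levi_civita_congr\<close>.\<close>
    also have "(\<Sum>a\<in>UNIV. \<Sum>b\<in>UNIV. \<Sum>c\<in>UNIV. \<Sum>d\<in>UNIV. \<Sum>\<gamma>\<in>UNIV. \<Sum>\<delta>\<in>UNIV. ?f a b c d \<gamma> \<delta>)
       = (\<Sum>\<gamma>\<in>UNIV. \<Sum>\<delta>\<in>UNIV. \<Sum>a\<in>UNIV. \<Sum>b\<in>UNIV. \<Sum>c\<in>UNIV. \<Sum>d\<in>UNIV. ?f a b c d \<gamma> \<delta>)"
    proof -
      note c = sum.cong[OF refl]
      have "(\<Sum>a\<in>UNIV. \<Sum>b\<in>UNIV. \<Sum>c\<in>UNIV. \<Sum>d\<in>UNIV. \<Sum>\<gamma>\<in>UNIV. \<Sum>\<delta>\<in>UNIV. ?f a b c d \<gamma> \<delta>)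
          = (\<Sum>a\<in>UNIV. \<Sum>b\<in>UNIV. \<Sum>c\<in>UNIV. \<Sum>\<gamma>\<in>UNIV. \<Sum>\<delta>\<in>UNIV. \<Sum>d\<in>UNIV. ?f a b c d \<gamma> \<delta>)"
        by (rule c, rule c, rule c, rule sum_swap_inner)
      also have "\<dots> = (\<Sum>a\<in>UNIV. \<Sum>b\<in>UNIV. \<Sum>\<gamma>\<in>UNIV. \<Sum>\<delta>\<in>UNIV. \<Sum>c\<in>UNIV. \<Sum>d\<in>UNIV. ?f a b c d \<gamma> \<delta>)"
        by (rule c, rule c, rule sum_swap_inner)
      also have "\<dots> = (\<Sum>a\<in>UNIV. \<Sum>\<gamma>\<in>UNIV. \<Sum>\<delta>\<in>UNIV. \<Sum>b\<in>UNIV. \<Sum>c\<in>UNIV. \<Sum>d\<in>UNIV. ?f a b c d \<gamma> \<delta>)"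
        by (rule c, rule sum_swap_inner)
      also have "\<dots> = (\<Sum>\<gamma>\<in>UNIV. \<Sum>\<delta>\<in>UNIV. \<Sum>a\<in>UNIV. \<Sum>b\<in>UNIV. \<Sum>c\<in>UNIV. \<Sum>d\<in>UNIV. ?f a b c d \<gamma> \<delta>)"
        by (rule sum_swap_inner)
      finally show ?thesis .
    qed
    also have "\<dots> = (\<Sum>\<gamma>\<in>UNIV. \<Sum>\<delta>\<in>UNIV. det L * levi_civita \<alpha> \<beta> \<gamma> \<delta> * R' $ \<gamma> $ \<delta>)"
      by (simp add: levi_civita_congr flip: sum_distrib_right)
    also have "\<dots> = det L * (\<Sum>\<gamma>\<in>UNIV. \<Sum>\<delta>\<in>UNIV. levi_civita \<alpha> \<beta> \<gamma> \<delta> * R' $ \<gamma> $ \<delta>)"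
      by (simp add: sum_distrib_left mult.assoc)
    also have "1/2 * sqrt (- det g) * \<dots> = sgn (det L) * hodge (congr L g) (congr L F) $ \<alpha> $ \<beta>"
    proof -
      have "sqrt (- det (congr L g)) = \<bar>det L\<bar> * sqrt (- det g)"
        unfolding det_congr by (metis mult_minus_right real_sqrt_abs real_sqrt_mult)
      then have "sgn (det L) * sqrt (- det (congr L g)) = det L * sqrt (- det g)"
        by (simp add: sgn_mult_abs flip: mult.assoc)
      then show ?thesis unfolding hodge_nth R'_def[symmetric] by (simp add: mult_ac)
    qed
    finally show "congr L (hodge g F) $ \<alpha> $ \<beta> = (sgn (det L) *\<^sub>R hodge (congr L g) (congr L F)) $ \<alpha> $ \<beta>"
      by simp
  qed
qed

section \<open>Components in an orthonormal frame\<close>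

text \<open>The entries \<open>(2,3)\<close>, \<open>(3,1)\<close>, \<open>(1,2)\<close> are \<open>b1, b2, b3\<close>, so that the Minkowski Hodge dual sends
  \<open>(a, b)\<close> to \<open>(b, -a)\<close>.\<close>
definition skew4 :: "real \<Rightarrow> real \<Rightarrow> real \<Rightarrow> real \<Rightarrow> real \<Rightarrow> real \<Rightarrow> real^4^4" where
  "skew4 a1 a2 a3 b1 b2 b3 = (\<chi> i j.
     if i = 0 then (if j = 0 then 0 else if j = 1 then a1 else if j = 2 then a2 else a3)
     else if i = 1 then (if j = 0 then - a1 else if j = 1 then 0 else if j = 2 then b3 else - b2)
     else if i = 2 then (if j = 0 then - a2 else if j = 1 then - b3 else if j = 2 then 0 else b1)
     else (if j = 0 then - a3 else if j = 1 then b2 else if j = 2 then - b1 else 0))"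

lemma skew4_nth [simp]:
  "skew4 a1 a2 a3 b1 b2 b3 $ 0 $ 0 = 0" "skew4 a1 a2 a3 b1 b2 b3 $ 0 $ 1 = a1"
  "skew4 a1 a2 a3 b1 b2 b3 $ 0 $ 2 = a2" "skew4 a1 a2 a3 b1 b2 b3 $ 0 $ 3 = a3"
  "skew4 a1 a2 a3 b1 b2 b3 $ 1 $ 0 = - a1" "skew4 a1 a2 a3 b1 b2 b3 $ 1 $ 1 = 0"
  "skew4 a1 a2 a3 b1 b2 b3 $ 1 $ 2 = b3" "skew4 a1 a2 a3 b1 b2 b3 $ 1 $ 3 = - b2"
  "skew4 a1 a2 a3 b1 b2 b3 $ 2 $ 0 = - a2" "skew4 a1 a2 a3 b1 b2 b3 $ 2 $ 1 = - b3"
  "skew4 a1 a2 a3 b1 b2 b3 $ 2 $ 2 = 0" "skew4 a1 a2 a3 b1 b2 b3 $ 2 $ 3 = b1"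
  "skew4 a1 a2 a3 b1 b2 b3 $ 3 $ 0 = - a3" "skew4 a1 a2 a3 b1 b2 b3 $ 3 $ 1 = b2"
  "skew4 a1 a2 a3 b1 b2 b3 $ 3 $ 2 = - b1" "skew4 a1 a2 a3 b1 b2 b3 $ 3 $ 3 = 0"
  by (simp_all add: skew4_def)

lemma diag4_nth [simp]:
  "diag4 d0 d1 d2 d3 $ 0 $ j = (if j = 0 then d0 else 0)" "diag4 d0 d1 d2 d3 $ 1 $ j = (if j = 1 then d1 else 0)"
  "diag4 d0 d1 d2 d3 $ 2 $ j = (if j = 2 then d2 else 0)" "diag4 d0 d1 d2 d3 $ 3 $ j = (if j = 3 then d3 else 0)"
  by (auto simp add: diag4_def)

lemma skew_eq_skew4:
  assumes "transpose f = - (f::real^4^4)"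
  shows "f = skew4 (f$0$1) (f$0$2) (f$0$3) (f$2$3) (f$3$1) (f$1$2)"
proof -
  have "f $ j $ i = - f $ i $ j" for i j
    using arg_cong[OF assms, of "\<lambda>h. h $ i $ j"] by (simp add: transpose_def)
  from this[of 0 0] this[of 1 1] this[of 2 2] this[of 3 3] this[of 0 1] this[of 0 2] this[of 0 3] this[of 2 3] this[of 3 1] this[of 1 2]
  show ?thesis by (simp add: vec_eq_iff all_4)
qed

lemma det_minkowski: "det minkowski = -1"
  by (simp add: det_4)

lemma matrix_inv_minkowski: "matrix_inv minkowski = minkowski"
  by (rule matrix_inv_unique) (simp add: vec_eq_iff all_4 matrix_matrix_mult_def sum_UNIV_4 mat_def)

lemma hodge_minkowski: "hodge minkowski (skew4 a1 a2 a3 b1 b2 b3) = skew4 b1 b2 b3 (-a1) (-a2) (-a3)"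
proof -
  let ?f = "skew4 a1 a2 a3 b1 b2 b3"
  \<comment> \<open>Raising both indices changes the sign of exactly the entries with a single index
    0.\<close>
  have R: "minkowski ** ?f ** transpose minkowski = skew4 (-a1) (-a2) (-a3) b1 b2 b3"
    by (simp add: vec_eq_iff all_4 matrix_matrix_mult_def sum_UNIV_4 transpose_def)
  have ax: "axis (i::4) (1::real) $ j = (if j = i then 1 else 0)" for i j by (auto simp: axis_def)
  show ?thesis
    unfolding vec_eq_iff all_4 hodge_nth matrix_inv_minkowski R det_minkowski
    by (simp add: sum_UNIV_4 levi_civita_eq_det det_4 ax)
qed

lemma form_ip_minkowski:
  "form_ip minkowski (skew4 a1 a2 a3 b1 b2 b3) (skew4 c1 c2 c3 d1 d2 d3)
    = b1 * d1 + b2 * d2 + b3 * d3 - (a1 * c1 + a2 * c2 + a3 * c3)"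
  unfolding form_ip_eq_trace matrix_inv_minkowski
  by (simp add: trace_def matrix_matrix_mult_def transpose_def sum_UNIV_4)

lemma psi_minkowski:
  "psi minkowski (skew4 a1 a2 a3 b1 b2 b3) = b1\<^sup>2 + b2\<^sup>2 + b3\<^sup>2 - (a1\<^sup>2 + a2\<^sup>2 + a3\<^sup>2)"
  by (simp add: psi_def form_ip_minkowski power2_eq_square)

lemma phi_minkowski:
  "phi minkowski (skew4 a1 a2 a3 b1 b2 b3) = - 2 * (a1 * b1 + a2 * b2 + a3 * b3)"
  by (simp add: phi_def hodge_minkowski form_ip_minkowski)

lemma form_ip_scaleR_right: "form_ip h G (c *\<^sub>R H) = c * form_ip h G H"
  by (simp add: form_ip_def sum_distrib_left mult_ac)

lemma phi_congr:
  assumes "det L \<noteq> 0" "det g \<noteq> 0"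
  shows "phi (congr L g) (congr L F) = sgn (det L) * phi g F"
proof -
  have "hodge (congr L g) (congr L F) = sgn (det L) *\<^sub>R congr L (hodge g F)"
    unfolding hodge_congr[OF assms] using assms(1) by (simp add: sgn_if)
  then show ?thesis unfolding phi_def by (simp add: form_ip_scaleR_right form_ip_congr[OF assms])
qed

text \<open>The polynomial is t^4 + psi t^2 - phi^2/4, with constant term minus the square of the
  Pfaffian of \<open>f\<close>. Applying \<open>M\<close> componentwise leaves a polynomial identity
  in the entries.\<close>

lemma cayley_hamilton_minkowski:
  fixes a1 a2 a3 b1 b2 b3 :: real
  defines "f \<equiv> skew4 a1 a2 a3 b1 b2 b3"
  defines "M \<equiv> minkowski ** f"
  shows "M *v (M *v (M *v (M *v v))) + psi minkowski f *\<^sub>R (M *v (M *v v)) = ((phi minkowski f)\<^sup>2 / 4) *\<^sub>R v"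
proof -
  have M: "(M *v v) $ 0 = a1 * v$1 + a2 * v$2 + a3 * v$3" "(M *v v) $ 1 = a1 * v$0 - b3 * v$2 + b2 * v$3"
     "(M *v v) $ 2 = a2 * v$0 + b3 * v$1 - b1 * v$3" "(M *v v) $ 3 = a3 * v$0 - b2 * v$1 + b1 * v$2" for v
    unfolding M_def f_def by (simp_all add: matrix_matrix_mult_def matrix_vector_mult_def sum_UNIV_4)
  show ?thesis
    unfolding vec_eq_iff all_4 f_def psi_minkowski phi_minkowski vector_add_component vector_scaleR_component M
    by (intro conjI) (simp_all add: field_simps power2_eq_square)
qed

section \<open>Transfer from Minkowski components to a Lorentzian metric\<close>

lemma lorentzian_frame:
  assumes "lorentzian g"
  obtains P where "congr P g = minkowski" "det P \<noteq> 0" "det g < 0"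
proof -
  obtain v where v: "\<And>\<mu> \<nu>. ip g (v \<mu>) (v \<nu>) = minkowski $ \<mu> $ \<nu>"
    using assms unfolding lorentzian_def by auto
  have c: "congr (\<chi> \<mu>. v \<mu>) g = minkowski" by (simp add: vec_eq_iff congr_nth v)
  then have d: "(det (\<chi> \<mu>. v \<mu>))\<^sup>2 * det g = -1" using det_congr det_minkowski by metis
  then have "det (\<chi> \<mu>. v \<mu>) \<noteq> 0" by auto
  moreover from d have "det g < 0"
    by (metis zero_le_power2 mult_nonneg_nonneg not_le neg_0_le_iff_le not_one_le_zero)
  ultimately show thesis using that c by blast
qed

lemma ip_congr: "ip (congr P g) x y = ip g (transpose P *v x) (transpose P *v y)"
proof -
  have "congr P g *v y = P *v (g *v (y v* P))"
    by (simp add: congr_def flip: matrix_vector_mul_assoc)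
  then show ?thesis by (simp add: ip_eq_inner dot_lmul_matrix)
qed

lemma transpose_matrix_inv:
  fixes P :: "real^'n^'n"
  assumes "det P \<noteq> 0"
  shows "transpose P *v (transpose (matrix_inv P) *v x) = x"
    "transpose (matrix_inv P) *v (transpose P *v x) = x"
  unfolding matrix_vector_mul_assoc
  by (simp_all add: assms matrix_inv_left matrix_inv_right flip: matrix_transpose_mul)

text \<open>Similarity carries the Minkowski identity over. The frame may have either orientation,
  which is harmless because phi enters squared.\<close>

lemma cayley_hamilton:
  assumes "lorentzian g" "transpose F = - F"
  defines "M \<equiv> matrix_inv g ** F"
  shows "M *v (M *v (M *v (M *v v))) + psi g F *\<^sub>R (M *v (M *v v)) = ((phi g F)\<^sup>2 / 4) *\<^sub>R v"
proof -
  obtain P where P: "congr P g = minkowski" "det P \<noteq> 0" "det g < 0"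
    using lorentzian_frame[OF assms(1)] .
  then have g: "det g \<noteq> 0" by simp
  let ?f = "congr P F" and ?K = "transpose (matrix_inv P)" and ?P = "transpose P"
  have "transpose ?f = - ?f"
    unfolding transpose_congr assms(2) by (simp add: vec_eq_iff congr_nth ip_def sum_negf)
  note f = skew_eq_skew4[OF this]
  define M' where "M' = minkowski ** ?f"
  have "M' = ?K ** M ** ?P"
    using raise_congr[OF P(2) g, of F] unfolding M'_def M_def P matrix_inv_minkowski .
  then have M: "M *v v = ?P *v (M' *v (?K *v v))" for v
    by (simp add: transpose_matrix_inv[OF P(2)] del: transpose_matrix_vector flip: matrix_vector_mul_assoc)
  have ps: "psi g F = psi minkowski ?f" "(phi g F)\<^sup>2 = (phi minkowski ?f)\<^sup>2"
    using psi_congr[OF P(2) g, of F] phi_congr[OF P(2) g, of F] P(2)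
    by (simp_all add: P power_mult_distrib sgn_if)
  have "M' *v (M' *v (M' *v (M' *v (?K *v v)))) + psi minkowski ?f *\<^sub>R (M' *v (M' *v (?K *v v)))
      = ((phi minkowski ?f)\<^sup>2 / 4) *\<^sub>R (?K *v v)"
    using cayley_hamilton_minkowski[of "?f$0$1" "?f$0$2" "?f$0$3" "?f$2$3" "?f$3$1" "?f$1$2" "?K *v v"]
    unfolding M'_def f[symmetric] .
  from arg_cong[OF this, of "\<lambda>x. ?P *v x"]
  show ?thesis unfolding M ps transpose_matrix_inv[OF P(2)]
    by (simp add: matrix_vector_right_distrib matrix_vector_mult_scaleR transpose_matrix_inv[OF P(2)] del: transpose_matrix_vector)
qed

text \<open>If \<open>z\<close> were not space-like, orthogonality and the Cauchy-Schwarz inequality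
  for the spatial parts would bound (x0 z0)^2 by |x|^2 z0^2, which is less than x0^2 z0^2.\<close>

lemma minkowski_orthogonal_timelike:
  assumes "ip minkowski x x > 0" "ip minkowski x z = 0" "z \<noteq> 0"
  shows "ip minkowski z z < 0"
proof (rule ccontr)
  have m: "ip minkowski x y = x$0 * y$0 - (x$1 * y$1 + x$2 * y$2 + x$3 * y$3)" for x y
    by (simp add: ip_def sum_UNIV_4)
  let ?x = "(x$1)\<^sup>2 + (x$2)\<^sup>2 + (x$3)\<^sup>2" and ?z = "(z$1)\<^sup>2 + (z$2)\<^sup>2 + (z$3)\<^sup>2"
  let ?xz = "x$1 * z$1 + x$2 * z$2 + x$3 * z$3"
  assume "\<not> ip minkowski z z < 0"
  then have z: "?z \<le> (z$0)\<^sup>2" by (simp add: m power2_eq_square)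
  have x: "?x < (x$0)\<^sup>2" using assms(1) by (simp add: m power2_eq_square)
  have xz: "x$0 * z$0 = ?xz" using assms(2) by (simp add: m)
  have "?xz\<^sup>2 \<le> ?x * ?z"
  proof -
    \<comment> \<open>Lagrange's identity in three dimensions.\<close>
    have "?x * ?z - ?xz\<^sup>2 = (x$1 * z$2 - x$2 * z$1)\<^sup>2 + (x$1 * z$3 - x$3 * z$1)\<^sup>2 + (x$2 * z$3 - x$3 * z$2)\<^sup>2"
      by (simp add: power2_eq_square algebra_simps)
    then show ?thesis by (smt (verit) zero_le_power2)
  qed
  then have le: "(x$0)\<^sup>2 * (z$0)\<^sup>2 \<le> ?x * ?z" unfolding xz[symmetric] power_mult_distrib .
  \<comment> \<open>Needed for the strict inequality: a vector that is not space-like and has no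
    time component is zero.\<close>
  have "(z$0)\<^sup>2 > 0"
  proof (rule ccontr)
    assume "\<not> (z$0)\<^sup>2 > 0"
    then have z0: "z$0 = 0" by simp
    with z have "?z \<le> 0" by simp
    then have "z$1 = 0" "z$2 = 0" "z$3 = 0"
      by (smt (verit) zero_le_power2 power2_eq_iff power_zero_numeral zero_eq_power2)+
    with z0 assms(3) show False by (simp add: vec_eq_iff all_4)
  qed
  then have "?x * (z$0)\<^sup>2 < (x$0)\<^sup>2 * (z$0)\<^sup>2" using x by simp
  moreover have "?x * ?z \<le> ?x * (z$0)\<^sup>2" using z by (intro mult_left_mono) auto
  ultimately show False using le by linarith
qed

lemma orthogonal_timelike:
  assumes "lorentzian g" "ip g x x > 0" "ip g x z = 0" "z \<noteq> 0"
  shows "ip g z z < 0"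
proof -
  obtain P where P: "congr P g = minkowski" "det P \<noteq> 0" "det g < 0"
    using lorentzian_frame[OF assms(1)] .
  let ?K = "transpose (matrix_inv P)"
  have ip: "ip g x z = ip minkowski (?K *v x) (?K *v z)" for x z
    by (simp add: P(1)[symmetric] ip_congr transpose_matrix_inv[OF P(2)] del: transpose_matrix_vector)
  have "?K *v z \<noteq> 0"
    using assms(4) transpose_matrix_inv(1)[OF P(2), of z] by (metis matrix_vector_mult_0_right)
  with assms show ?thesis unfolding ip by (metis minkowski_orthogonal_timelike)
qed

text \<open>For an observer along \<open>t\<close> the field is purely magnetic. In vector notation
  the spatial rows of the hypothesis read t0 a = t x b, and Lagrange's identity gives t0^2 (|b|^2 -
  |a|^2) = (t0^2 - |t|^2) |b|^2 + (t.b)^2.\<close>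

lemma psi_nonneg_minkowski:
  assumes t: "ip minkowski t t > 0" and f: "skew4 a1 a2 a3 b1 b2 b3 *v t = 0"
  shows "psi minkowski (skew4 a1 a2 a3 b1 b2 b3) \<ge> 0"
proof -
  have t: "(t$0)\<^sup>2 > (t$1)\<^sup>2 + (t$2)\<^sup>2 + (t$3)\<^sup>2"
    using t by (simp add: ip_def sum_UNIV_4 power2_eq_square)
  have "(skew4 a1 a2 a3 b1 b2 b3 *v t) $ i = 0" for i using f by simp
  from this[of 1] this[of 2] this[of 3]
  have a: "t$0 * a1 = b3 * t$2 - b2 * t$3" "t$0 * a2 = b1 * t$3 - b3 * t$1" "t$0 * a3 = b2 * t$1 - b1 * t$2"
    by (simp_all add: matrix_vector_mult_def sum_UNIV_4 algebra_simps)
  have "(t$0)\<^sup>2 * psi minkowski (skew4 a1 a2 a3 b1 b2 b3)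
    = (t$0)\<^sup>2 * (b1\<^sup>2 + b2\<^sup>2 + b3\<^sup>2) - ((t$0 * a1)\<^sup>2 + (t$0 * a2)\<^sup>2 + (t$0 * a3)\<^sup>2)"
    by (simp add: psi_minkowski power_mult_distrib algebra_simps)
  also have "\<dots> = ((t$0)\<^sup>2 - ((t$1)\<^sup>2 + (t$2)\<^sup>2 + (t$3)\<^sup>2)) * (b1\<^sup>2 + b2\<^sup>2 + b3\<^sup>2) + (t$1 * b1 + t$2 * b2 + t$3 * b3)\<^sup>2"
    unfolding a by (simp add: power2_eq_square algebra_simps)
  also have "\<dots> \<ge> 0" using t by (intro add_nonneg_nonneg mult_nonneg_nonneg) auto
  finally have "(t$0)\<^sup>2 * psi minkowski (skew4 a1 a2 a3 b1 b2 b3) \<ge> 0" .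
  moreover have "(t$0)\<^sup>2 > 0" using t by (smt (verit) zero_le_power2)
  ultimately show ?thesis by (simp add: zero_le_mult_iff)
qed

lemma psi_nonneg:
  assumes "lorentzian g" "transpose F = - F" "ip g x x > 0" "F *v x = 0"
  shows "psi g F \<ge> 0"
proof -
  obtain P where P: "congr P g = minkowski" "det P \<noteq> 0" "det g < 0"
    using lorentzian_frame[OF assms(1)] .
  let ?f = "congr P F" and ?K = "transpose (matrix_inv P)"
  have "transpose ?f = - ?f"
    unfolding transpose_congr assms(2) by (simp add: vec_eq_iff congr_nth ip_def sum_negf)
  note f = skew_eq_skew4[OF this]
  have "ip minkowski (?K *v x) (?K *v x) > 0"
    using assms(3) by (simp add: P(1)[symmetric] ip_congr transpose_matrix_inv[OF P(2)] del: transpose_matrix_vector)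
  moreover have "?f *v (?K *v x) = 0"
    unfolding congr_def using assms(4)
    by (simp add: transpose_matrix_inv[OF P(2)] del: transpose_matrix_vector flip: matrix_vector_mul_assoc)
  ultimately have "psi minkowski ?f \<ge> 0"
    using psi_nonneg_minkowski f by metis
  then show ?thesis using psi_congr[OF P(2), of g F] P by simp
qed

section \<open>Frames adapted to a 2-form\<close>

text \<open>The minus sign makes \<open>\<beta>\<close> the magnetic coefficient: the dual form has
  value -\<beta> on \<open>e 0\<close>, \<open>e 1\<close>, and raising the space-like index changes
  the sign once more. No signs of \<open>\<alpha>\<close> and \<open>\<beta>\<close> are imposed, so
  that dual and reversed frames fit the same predicate.\<close>

definition wrench_frame ::
    "real^4^4 \<Rightarrow> real^4 \<Rightarrow> real^4^4 \<Rightarrow> (4 \<Rightarrow> real^4) \<Rightarrow> real \<Rightarrow> real \<Rightarrow> bool" where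
  "wrench_frame g T F e \<alpha> \<beta> \<longleftrightarrow>
     congr (vec_lambda e) g = minkowski \<and> det (vec_lambda e) > 0 \<and> ip g (e 0) T > 0 \<and>
     congr (vec_lambda e) F = skew4 \<alpha> 0 0 (- \<beta>) 0 0"

lemma ip_add_left: "ip h (U + V) W = ip h U W + ip h V W"
  and ip_add_right: "ip h U (V + W) = ip h U V + ip h U W"
  and ip_diff_left: "ip h (U - V) W = ip h U W - ip h V W"
  and ip_diff_right: "ip h U (V - W) = ip h U V - ip h U W"
  and ip_scaleR_left: "ip h (c *\<^sub>R U) W = c * ip h U W"
  and ip_scaleR_right: "ip h U (c *\<^sub>R W) = c * ip h U W"
  and ip_zero_left: "ip h 0 W = 0"
  and ip_zero_right: "ip h U 0 = 0"
  by (simp_all add: ip_eq_inner inner_simps matrix_vector_right_distrib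
      matrix_vector_mult_diff_distrib matrix_vector_mult_scaleR)

lemmas ip_simps = ip_add_left ip_add_right ip_diff_left ip_diff_right ip_scaleR_left ip_scaleR_right
  ip_zero_left ip_zero_right

lemma ip_commute: "transpose h = h \<Longrightarrow> ip h U V = ip h V U"
  unfolding ip_eq_inner by (metis dot_lmul_matrix inner_commute transpose_matrix_vector)

lemma ip_add_form: "ip (h + k) U V = ip h U V + ip k U V"
  by (simp add: ip_def sum.distrib algebra_simps)

lemma ip_scaleR_form: "ip (c *\<^sub>R h) U V = c * ip h U V"
  by (simp add: ip_def sum_distrib_left mult_ac)

lemma wrench_frame_det:
  assumes "wrench_frame g T F e \<alpha> \<beta>"
  shows "det (vec_lambda e) \<noteq> 0" "det g \<noteq> 0"
  using assms det_congr[of "vec_lambda e" g] det_minkowski unfolding wrench_frame_def by auto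

lemma wrench_frame_psi: "wrench_frame g T F e \<alpha> \<beta> \<Longrightarrow> psi g F = \<beta>\<^sup>2 - \<alpha>\<^sup>2"
  using psi_congr[OF wrench_frame_det] unfolding wrench_frame_def
  by (metis (no_types, lifting) psi_minkowski add.right_neutral power2_minus power_zero_numeral)

lemma wrench_frame_hodge:
  "wrench_frame g T F e \<alpha> \<beta> \<Longrightarrow> congr (vec_lambda e) (hodge g F) = skew4 (- \<beta>) 0 0 (- \<alpha>) 0 0"
  using hodge_congr[OF wrench_frame_det, of g T F e \<alpha> \<beta>] by (simp add: wrench_frame_def hodge_minkowski)

lemma wrench_frame_phi:
  assumes "wrench_frame g T F e \<alpha> \<beta>"
  shows "phi g F = 2 * \<alpha> * \<beta>"
proof -
  have "phi g F = phi minkowski (skew4 \<alpha> 0 0 (- \<beta>) 0 0)"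
    using phi_congr[OF wrench_frame_det[OF assms], of F] assms by (simp add: wrench_frame_def)
  then show ?thesis by (simp add: phi_minkowski)
qed

lemma wrench_frame_kappa:
  assumes "wrench_frame g T F e \<alpha> \<beta>"
  shows "kappa g F = (\<alpha>\<^sup>2 + \<beta>\<^sup>2) / 2"
proof -
  have "(psi g F)\<^sup>2 + (phi g F)\<^sup>2 = (\<alpha>\<^sup>2 + \<beta>\<^sup>2)\<^sup>2"
    unfolding wrench_frame_psi[OF assms] wrench_frame_phi[OF assms]
    by (simp add: power2_eq_square algebra_simps)
  then show ?thesis by (simp add: kappa_def)
qed

text \<open>Nondegeneracy makes lowering an index injective, which justifies the definite
  descriptions in \<open>electric\<close> and \<open>magnetic\<close>.\<close>

lemma the_flat:
  assumes "det g \<noteq> 0" "flat g v = w"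
  shows "(THE u. flat g u = w) = v"
proof (rule the_equality)
  have flat: "flat g u = g *v u" for u
    by (simp add: flat_def matrix_vector_mult_def)
  fix u assume "flat g u = w"
  then have "matrix_inv g *v (g *v u) = matrix_inv g *v (g *v v)" using assms(2) by (simp add: flat)
  then show "u = v" by (simp add: matrix_vector_mul_assoc matrix_inv_left[OF assms(1)])
qed (rule assms)

lemma matrix_vector_mult_cancel: "det (P::real^'n^'n) \<noteq> 0 \<Longrightarrow> P *v u = P *v v \<Longrightarrow> u = v"
  by (metis matrix_inv_left matrix_vector_mul_assoc matrix_vector_mul_lid)

text \<open>The frame matrix evaluates a covector on the frame vectors, so an equation of covectors
  can be checked there.\<close>

lemma frame_flat_nth: "(vec_lambda e *v flat g u) $ \<mu> = ip g (e \<mu>) u"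
  by (simp add: ip_eq_inner flat_def matrix_vector_mult_def inner_vec_def)

lemma frame_interior_mult_nth: "(vec_lambda e *v interior_mult u G) $ \<mu> = ip G u (e \<mu>)"
  by (simp add: matrix_vector_mult_def interior_mult_def ip_def sum_distrib_left mult_ac) (rule sum.swap)

lemma wrench_frame_electric:
  assumes "wrench_frame g T F e \<alpha> \<beta>"
  shows "electric g F (e 0) = \<alpha> *\<^sub>R e 1"
  unfolding electric_def
proof (rule the_flat[OF wrench_frame_det(2)[OF assms]],
    rule matrix_vector_mult_cancel[OF wrench_frame_det(1)[OF assms]])
  have "ip g (e \<mu>) (e 1) = minkowski $ \<mu> $ 1" "ip F (e 0) (e \<mu>) = skew4 \<alpha> 0 0 (- \<beta>) 0 0 $ 0 $ \<mu>" for \<mu>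
    using assms congr_nth[of "vec_lambda e"] unfolding wrench_frame_def by (metis vec_lambda_beta)+
  then show "vec_lambda e *v flat g (\<alpha> *\<^sub>R e 1) = vec_lambda e *v - interior_mult (e 0) F"
    \<comment> \<open>Instantiated at 0, linearity moves the minus sign out of the product.\<close>
    using matrix_vector_mult_diff_distrib[of "vec_lambda e" 0 "interior_mult (e 0) F"]
    by (simp add: vec_eq_iff frame_flat_nth frame_interior_mult_nth ip_scaleR_right all_4)
qed

lemma wrench_frame_magnetic:
  assumes "wrench_frame g T F e \<alpha> \<beta>"
  shows "magnetic g F (e 0) = \<beta> *\<^sub>R e 1"
  unfolding magnetic_def
proof (rule the_flat[OF wrench_frame_det(2)[OF assms]],
    rule matrix_vector_mult_cancel[OF wrench_frame_det(1)[OF assms]])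
  have "ip g (e \<mu>) (e 1) = minkowski $ \<mu> $ 1" for \<mu>
    using assms congr_nth[of "vec_lambda e"] unfolding wrench_frame_def by (metis vec_lambda_beta)
  moreover have "ip (hodge g F) (e 0) (e \<mu>) = skew4 (- \<beta>) 0 0 (- \<alpha>) 0 0 $ 0 $ \<mu>" for \<mu>
    using wrench_frame_hodge[OF assms] congr_nth[of "vec_lambda e"] by (metis vec_lambda_beta)
  ultimately show "vec_lambda e *v flat g (\<beta> *\<^sub>R e 1) = vec_lambda e *v interior_mult (e 0) (hodge g F)"
    by (simp add: vec_eq_iff frame_flat_nth frame_interior_mult_nth ip_scaleR_right all_4)
qed

lemma wrench_frame_form_sq:
  assumes "wrench_frame g T F e \<alpha> \<beta>"
  shows "ip (form_sq g F) (e \<mu>) (e \<nu>) = diag4 (\<alpha>\<^sup>2) (- (\<alpha>\<^sup>2)) (\<beta>\<^sup>2) (\<beta>\<^sup>2) $ \<mu> $ \<nu>"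
proof -
  let ?P = "vec_lambda e"
  let ?f = "skew4 \<alpha> 0 0 (- \<beta>) 0 0"
  have gi: "matrix_inv g = congr (transpose ?P) minkowski"
    using matrix_inv_congr_back[OF wrench_frame_det[OF assms]] assms
    by (simp add: wrench_frame_def matrix_inv_minkowski)
  have "congr ?P (form_sq g F) = congr ?P F ** minkowski ** congr ?P F"
    unfolding form_sq_def gi by (simp add: congr_def matrix_mul_assoc)
  also have "\<dots> = ?f ** minkowski ** ?f"
    using assms by (simp add: wrench_frame_def)
  also have "\<dots> = diag4 (\<alpha>\<^sup>2) (- (\<alpha>\<^sup>2)) (\<beta>\<^sup>2) (\<beta>\<^sup>2)"
    by (simp add: vec_eq_iff all_4 matrix_matrix_mult_def sum_UNIV_4 power2_eq_square)
  finally show ?thesis using congr_nth[of ?P "form_sq g F" \<mu> \<nu>] by simp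
qed

text \<open>By \<open>wrench_frame_form_sq\<close>, the square of \<open>F\<close> is \<alpha>^2
  times \<open>g\<close> on the plane of \<open>e 0\<close>, \<open>e 1\<close> and -\<beta>^2 times
  \<open>g\<close> on the complement. Adding half of psi balances the two factors to kappa and
  -kappa, so the disformal metric is \<open>- g\<close> on the plane and \<open>g\<close> on the
  complement.\<close>

lemma wrench_frame_imp_adapted_tetrad:
  assumes w: "wrench_frame g T F e \<alpha> \<beta>" and "kappa g F \<noteq> 0"
    and "psi g F \<le> 0 \<Longrightarrow> \<alpha> > 0" "psi g F > 0 \<Longrightarrow> \<beta> > 0"
  shows "adapted_tetrad g T F e"
proof -
  have g: "ip g (e \<mu>) (e \<nu>) = minkowski $ \<mu> $ \<nu>" for \<mu> \<nu>
    using w congr_nth[of "vec_lambda e"] unfolding wrench_frame_def by (metis vec_lambda_beta)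
  have s: "\<alpha>\<^sup>2 + \<beta>\<^sup>2 \<noteq> 0" using assms(2) wrench_frame_kappa[OF w] by simp
  have "ip (disformal g F) (e \<mu>) (e \<nu>)
      = - inverse ((\<alpha>\<^sup>2 + \<beta>\<^sup>2) / 2) * (diag4 (\<alpha>\<^sup>2) (- (\<alpha>\<^sup>2)) (\<beta>\<^sup>2) (\<beta>\<^sup>2) $ \<mu> $ \<nu> + (\<beta>\<^sup>2 - \<alpha>\<^sup>2) / 2 * minkowski $ \<mu> $ \<nu>)" for \<mu> \<nu>
    unfolding disformal_def ip_scaleR_form ip_add_form wrench_frame_form_sq[OF w] g
      wrench_frame_kappa[OF w] wrench_frame_psi[OF w] ..
  moreover have "\<forall>\<mu> \<nu>. - inverse ((\<alpha>\<^sup>2 + \<beta>\<^sup>2) / 2) * (diag4 (\<alpha>\<^sup>2) (- (\<alpha>\<^sup>2)) (\<beta>\<^sup>2) (\<beta>\<^sup>2) $ \<mu> $ \<nu> + (\<beta>\<^sup>2 - \<alpha>\<^sup>2) / 2 * minkowski $ \<mu> $ \<nu>)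
     = diag4 (-1) 1 (-1) (-1) $ \<mu> $ \<nu>"
    unfolding all_4 using s by (simp add: divide_simps del: sum_power2_eq_zero_iff)
  ultimately have d: "ip (disformal g F) (e \<mu>) (e \<nu>) = diag4 (-1) 1 (-1) (-1) $ \<mu> $ \<nu>" for \<mu> \<nu>
    by simp
  have rows: "rows4 (e 0) (e 1) (e 2) (e 3) = vec_lambda e"
    by (simp add: vec_eq_iff all_4)
  have "wrench_pair g T F (e 0) (e 1)"
    unfolding wrench_pair_def observer_def wrench_frame_electric[OF w] wrench_frame_magnetic[OF w]
    using w assms(3,4) g by (auto simp: wrench_frame_def)
  moreover have "right_handed_triad g (e 0) (e 1) (e 2) (e 3)"
    unfolding right_handed_triad_def rows using w g by (simp add: wrench_frame_def)
  moreover have "timelike (disformal g F) (c *\<^sub>R e 1)" if "c *\<^sub>R e 1 \<noteq> 0" for c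
    using that d[of 1 1] by (auto simp: timelike_def ip_simps zero_less_mult_iff)
  ultimately show ?thesis
    unfolding adapted_tetrad_def wrench_frame_electric[OF w] wrench_frame_magnetic[OF w]
    using g d by (simp add: timelike_def spacelike_def)
qed

lemma wrench_frame_coord_change:
  assumes "wrench_frame (transpose J ** g ** J) T (transpose J ** F ** J) e \<alpha> \<beta>" "det J > 0"
  shows "wrench_frame g (J *v T) F (\<lambda>\<mu>. J *v e \<mu>) \<alpha> \<beta>"
proof -
  have P: "vec_lambda (\<lambda>\<mu>. J *v e \<mu>) = vec_lambda e ** transpose J"
    by (simp add: vec_eq_iff matrix_vector_mult_def matrix_matrix_mult_def transpose_def mult_ac)
  have c: "transpose J ** h ** J = congr (transpose J) h" for h by (simp add: congr_def)
  show ?thesis using assms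
    unfolding wrench_frame_def P congr_congr[symmetric] c ip_congr
    by (simp add: det_mul)
qed

text \<open>The reversal is the rotation by the angle \<pi> in the plane of \<open>e 1\<close>,
  \<open>e 2\<close>. It keeps the metric, the orientation and the observer, and reverses both
  coefficients.\<close>

lemma wrench_frame_reverse_wrench:
  assumes "wrench_frame g T F e \<alpha> \<beta>"
  shows "wrench_frame g T F (reverse_wrench e) (- \<alpha>) (- \<beta>)"
proof -
  let ?D = "diag4 1 (-1) (-1) 1"
  have P: "vec_lambda (reverse_wrench e) = ?D ** vec_lambda e"
    by (simp add: vec_eq_iff all_4 reverse_wrench_def matrix_matrix_mult_def sum_UNIV_4)
  have 0: "reverse_wrench e 0 = e 0" by (simp add: reverse_wrench_def)
  have "congr ?D minkowski = minkowski"
    "congr ?D (skew4 \<alpha> 0 0 (- \<beta>) 0 0) = skew4 (- \<alpha>) 0 0 (- (- \<beta>)) 0 0" "det ?D = 1"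
    by (simp_all add: congr_def vec_eq_iff all_4 matrix_matrix_mult_def sum_UNIV_4 transpose_def det_4)
  then show ?thesis using assms
    unfolding wrench_frame_def P 0 congr_congr[symmetric] by (simp add: det_mul)
qed

lemma congr_skew: "transpose F = - F \<Longrightarrow> transpose (congr P F) = - congr P (F::real^4^4)"
  unfolding transpose_congr by (simp add: vec_eq_iff congr_nth ip_def sum_negf)

text \<open>The electric vector of the form \<open>- hodge g F\<close> is the magnetic vector of
  \<open>F\<close>, and its magnetic vector is minus the electric vector of \<open>F\<close>. Since
  the Minkowski dual only permutes components up to sign, those of \<open>F\<close> can be read
  back.\<close>

lemma wrench_frame_of_dual:
  assumes w: "wrench_frame g T (- hodge g F) e \<alpha> \<beta>" and F: "transpose F = - F"
  shows "wrench_frame g T F e (- \<beta>) \<alpha>"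
proof -
  let ?P = "vec_lambda e"
  note f = skew_eq_skew4[OF congr_skew[OF F, of ?P]]
  have "congr ?P (- hodge g F) = - congr ?P (hodge g F)"
    by (simp add: vec_eq_iff congr_nth ip_def sum_negf)
  then have "congr ?P (- hodge g F) = - hodge minkowski (congr ?P F)"
    using hodge_congr[OF wrench_frame_det[OF w], of F] w by (simp add: wrench_frame_def)
  then have "skew4 \<alpha> 0 0 (- \<beta>) 0 0 = - hodge minkowski (congr ?P F)"
    using w by (simp add: wrench_frame_def)
  also have "hodge minkowski (congr ?P F) = hodge minkowski (skew4 (congr ?P F$0$1) (congr ?P F$0$2)
    (congr ?P F$0$3) (congr ?P F$2$3) (congr ?P F$3$1) (congr ?P F$1$2))"
    using f by simp
  finally have "congr ?P F$0$1 = - \<beta>" "congr ?P F$0$2 = 0" "congr ?P F$0$3 = 0"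
     "congr ?P F$2$3 = - \<alpha>" "congr ?P F$3$1 = 0" "congr ?P F$1$2 = 0"
    unfolding hodge_minkowski by (simp_all add: vec_eq_iff all_4)
  with f have "congr ?P F = skew4 (- \<beta>) 0 0 (- \<alpha>) 0 0" by simp
  with w show ?thesis by (simp add: wrench_frame_def)
qed

text \<open>All three are read off in an orthonormal frame of unknown orientation, whose sign
  \<open>?s\<close> drops out through its square. Because psi changes sign and kappa does not, kappa
  - psi/2 for the dual is kappa + psi/2 for \<open>F\<close>.\<close>

lemma
  assumes "lorentzian g" and F: "transpose F = - F"
  shows transpose_hodge: "transpose (hodge g F) = - hodge g F"
    and psi_dual: "psi g (- hodge g F) = - psi g F"
    and kappa_dual: "kappa g (- hodge g F) = kappa g F"
proof -
  obtain P where P: "congr P g = minkowski" "det P \<noteq> 0" "det g < 0"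
    using lorentzian_frame[OF assms(1)] .
  then have g: "det g \<noteq> 0" by simp
  note f = skew_eq_skew4[OF congr_skew[OF F, of P]]
  let ?s = "sgn (det P)"
  let ?f = "congr P F"
  have s: "?s * ?s = 1" using P(2) by (simp add: sgn_if)
  obtain a1 a2 a3 b1 b2 b3 where f: "?f = skew4 a1 a2 a3 b1 b2 b3" using f by blast
  have h: "congr P (hodge g F) = skew4 (?s * b1) (?s * b2) (?s * b3) (- ?s * a1) (- ?s * a2) (- ?s * a3)"
    unfolding hodge_congr[OF P(2) g] P f hodge_minkowski by (simp add: vec_eq_iff all_4)
  moreover have "congr P (- hodge g F) = - congr P (hodge g F)"
    by (simp add: vec_eq_iff congr_nth ip_def sum_negf)
  ultimately have h': "congr P (- hodge g F) = skew4 (- ?s * b1) (- ?s * b2) (- ?s * b3) (?s * a1) (?s * a2) (?s * a3)"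
    by (simp add: vec_eq_iff all_4)
  have sq: "(?s * a)\<^sup>2 = a\<^sup>2" for a using s by (simp add: power2_eq_square algebra_simps)
  show psi: "psi g (- hodge g F) = - psi g F"
    unfolding psi_congr[OF P(2) g, symmetric] h' P f psi_minkowski by (simp add: sq)
  have "(phi minkowski (congr P (- hodge g F)))\<^sup>2 = (phi minkowski ?f)\<^sup>2"
    unfolding h' f phi_minkowski using s by (simp add: power2_eq_square algebra_simps) 
  then have "(phi g (- hodge g F))\<^sup>2 = (phi g F)\<^sup>2"
    using phi_congr[OF P(2) g] by (simp add: P power_mult_distrib sgn_if split: if_splits)
  with psi show "kappa g (- hodge g F) = kappa g F" by (simp add: kappa_def)
  let ?K = "matrix_inv P"
  have "hodge g F = congr ?K (congr P (hodge g F))"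
    unfolding congr_congr matrix_inv_left[OF P(2)] by (simp add: congr_def)
  moreover have "transpose (congr P (hodge g F)) = - congr P (hodge g F)"
    unfolding h by (simp add: vec_eq_iff all_4 transpose_def)
  ultimately show "transpose (hodge g F) = - hodge g F"
    by (metis congr_skew)
qed

section \<open>The wrench frame of a regular 2-form\<close>

lemma lorentzian_sym: "lorentzian g \<Longrightarrow> transpose g = g"
  by (simp add: lorentzian_def)

lemma lorentzian_det: "lorentzian g \<Longrightarrow> det g < 0"
  using lorentzian_frame by blast

section \<open>Oriented orthonormal completion of three vectors\<close>

lemma ex_not_in_span:
  fixes S :: "'a::euclidean_space set"
  assumes "finite S" "card S < DIM('a)"
  obtains v where "v \<notin> span S"
proof -
  have "span S \<noteq> UNIV"
    using dim_le_card[of UNIV S] assms dim_UNIV by fastforce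
  then show thesis using that by blast
qed

text \<open>The volume form contracted with \<open>x\<close>, \<open>y\<close>, \<open>z\<close>,
  with its free index raised. The minus sign is forced: pairing the result with itself should give
  -1 when the frame is positively oriented.\<close>

definition cross4 :: "real^4^4 \<Rightarrow> real^4 \<Rightarrow> real^4 \<Rightarrow> real^4 \<Rightarrow> real^4" where
  "cross4 g x y z =
     (- sqrt (- det g)) *\<^sub>R (matrix_inv g *v (\<chi> a. det (rows4 x y z (axis a 1))))"

lemma ip_cross4:
  assumes "det g \<noteq> 0"
  shows "ip g v (cross4 g x y z) = - sqrt (- det g) * det (rows4 x y z v)"
proof -
  have "ip g v (matrix_inv g *v (\<chi> a. det (rows4 x y z (axis a 1))))
      = v \<bullet> (\<chi> a. det (rows4 x y z (axis a 1)))"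
    by (simp add: ip_eq_inner matrix_vector_mul_assoc matrix_inv_right[OF assms])
  also have "\<dots> = det (rows4 x y z v)"
    unfolding det_rows4_expand(4)[of x y z v] by (simp add: inner_vec_def)
  finally show ?thesis by (simp only: cross4_def ip_scaleR_right)
qed

text \<open>Let \<open>d\<close> be the volume of \<open>x\<close>, \<open>y\<close>,
  \<open>z\<close>, \<open>?w\<close>. The Gram determinant gives d^2 = - g(w,w), the definition of
  \<open>cross4\<close> gives g(w,w) = -d, and hence d = 1 once \<open>?w\<close> is known to be
  nonzero.\<close>

lemma orthonormal_completion:
  assumes g: "lorentzian g"
    and x: "ip g x x = 1" "ip g x y = 0" "ip g x z = 0"
    and yz: "ip g y y = -1" "ip g y z = 0" "ip g z z = -1"
  shows "congr (rows4 x y z (cross4 g x y z)) g = minkowski"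
    and "det (rows4 x y z (cross4 g x y z)) > 0"
proof -
  let ?w = "cross4 g x y z"
  note com = ip_commute[OF lorentzian_sym[OF g]]
  define r where "r = sqrt (- det g)"
  have r: "r > 0" "det g = - r\<^sup>2" using lorentzian_det[OF g] by (simp_all add: r_def)
  then have cross: "ip g v ?w = - r * det (rows4 x y z v)" for v
    unfolding r_def using ip_cross4 by simp
  have "det (rows4 x y z x) = 0"
    by (rule det_identical_rows[of 0 3]) (simp_all add: row_def)
  moreover have "det (rows4 x y z y) = 0"
    by (rule det_identical_rows[of 1 3]) (simp_all add: row_def)
  moreover have "det (rows4 x y z z) = 0"
    by (rule det_identical_rows[of 2 3]) (simp_all add: row_def)
  ultimately have w: "ip g x ?w = 0" "ip g y ?w = 0" "ip g z ?w = 0"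
    by (simp_all add: cross)
  have gram: "congr (rows4 x y z v) g = diag4 1 (-1) (-1) (ip g v v)"
    if "ip g x v = 0" "ip g y v = 0" "ip g z v = 0" for v
    using that x yz com[of y x] com[of z x] com[of z y] com[of v x] com[of v y] com[of v z]
    by (simp add: vec_eq_iff all_4 congr_nth)
  have gram_det: "(r * det (rows4 x y z v))\<^sup>2 = - ip g v v"
    if "ip g x v = 0" "ip g y v = 0" "ip g z v = 0" for v
    using arg_cong[OF gram[OF that], of det] r
    by (simp add: det_congr det_4[of "diag4 _ _ _ _"] power_mult_distrib algebra_simps)
  have "card {x, y, z} \<le> 3" by (simp add: card_insert_if)
  then obtain v where v: "v \<notin> span {x, y, z}"
    using ex_not_in_span[of "{x, y, z}"] by auto
  \<comment> \<open>A nonzero vector orthogonal to the other three; pairing it with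
    \<open>?w\<close> shows that \<open>?w\<close> is nonzero. The plus signs come from
    \<open>y\<close> and \<open>z\<close> having norm -1.\<close>
  let ?v = "v - ip g x v *\<^sub>R x + ip g y v *\<^sub>R y + ip g z v *\<^sub>R z"
  have v0: "?v \<noteq> 0"
  proof
    assume "?v = 0"
    then have "v = ip g x v *\<^sub>R x - ip g y v *\<^sub>R y - ip g z v *\<^sub>R z" by (simp add: algebra_simps)
    also have "\<dots> \<in> span {x, y, z}" by (intro span_diff span_scale span_base) auto
    finally show False using v by simp
  qed
  have orth: "ip g x ?v = 0" "ip g y ?v = 0" "ip g z ?v = 0"
    using x yz com[of y x] com[of z x] com[of z y] by (simp_all add: ip_simps)
  have "ip g ?v ?v < 0" using orthogonal_timelike[OF g _ orth(1) v0] x(1) by simp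
  then have "ip g ?v ?w \<noteq> 0" using gram_det[OF orth] r by (auto simp: cross)
  then have "?w \<noteq> 0" by (auto simp: ip_simps)
  then have ww: "ip g ?w ?w < 0" using orthogonal_timelike[OF g _ w(1)] x(1) by simp
  define d where "d = r * det (rows4 x y z ?w)"
  have "d\<^sup>2 = d" using gram_det[OF w] cross[of ?w] by (simp add: d_def)
  moreover have "d \<noteq> 0" using ww cross[of ?w] by (auto simp: d_def)
  ultimately have d: "d = 1" by (simp add: power2_eq_square)
  then show "det (rows4 x y z ?w) > 0" using r by (simp add: d_def) (smt (verit) zero_less_mult_pos)
  have "ip g ?w ?w = -1" using d cross[of ?w] by (simp add: d_def)
  then show "congr (rows4 x y z ?w) g = minkowski" using gram[OF w] by simp
qed

text \<open>\<open>2\<kappa>\<close> times the projection of \<open>T\<close> onto the time-like eigenplane of \<open>M\<^sup>2\<close>.\<close>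
definition plane_projection :: "real^4^4 \<Rightarrow> real^4 \<Rightarrow> real^4^4 \<Rightarrow> real^4" where
  "plane_projection g T F = (kappa g F + psi g F / 2) *\<^sub>R T
     + matrix_inv g *v (F *v (matrix_inv g *v (F *v T)))"

definition plane_observer :: "real^4^4 \<Rightarrow> real^4 \<Rightarrow> real^4^4 \<Rightarrow> real^4" where
  "plane_observer g T F = (let Y = plane_projection g T F in inverse (sqrt (ip g Y Y)) *\<^sub>R Y)"

definition plane_normal :: "real^4^4 \<Rightarrow> real^4 \<Rightarrow> real^4^4 \<Rightarrow> real^4" where
  "plane_normal g T F =
     inverse (sqrt (kappa g F - psi g F / 2)) *\<^sub>R (matrix_inv g *v (F *v plane_observer g T F))"

text \<open>Orthogonal projection away from the plane of the observer and the wrench vector.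
  \<open>V\<close> will be a constant coordinate vector; its projection can be normalised as long as
  it stays nonzero.\<close>

definition off_plane :: "real^4^4 \<Rightarrow> real^4 \<Rightarrow> real^4^4 \<Rightarrow> real^4 \<Rightarrow> real^4" where
  "off_plane g T F V = V - ip g (plane_observer g T F) V *\<^sub>R plane_observer g T F
     + ip g (plane_normal g T F) V *\<^sub>R plane_normal g T F"

definition local_tetrad :: "real^4^4 \<Rightarrow> real^4 \<Rightarrow> real^4^4 \<Rightarrow> real^4 \<Rightarrow> 4 \<Rightarrow> real^4" where
  "local_tetrad g T F V \<mu> =
     (let X = plane_observer g T F; W = plane_normal g T F; Z = off_plane g T F V;
          E = inverse (sqrt (- ip g Z Z)) *\<^sub>R Z
      in if \<mu> = 0 then X else if \<mu> = 1 then W else if \<mu> = 2 then E else cross4 g X W E)"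

lemma ip_skew: "transpose F = - F \<Longrightarrow> ip F U V = - ip F V U"
proof -
  assume F: "transpose F = - F"
  have skew: "F $ i $ j = - F $ j $ i" for i j
    using arg_cong[OF F, of "\<lambda>h. h $ j $ i"] by (simp add: transpose_def)
  have "ip F U V = (\<Sum>i\<in>UNIV. \<Sum>j\<in>UNIV. - (F $ j $ i * V $ j * U $ i))"
    unfolding ip_def by (intro sum.cong refl, subst skew) (simp add: mult_ac)
  also have "\<dots> = - (\<Sum>i\<in>UNIV. \<Sum>j\<in>UNIV. F $ j $ i * V $ j * U $ i)"
    by (simp add: sum_negf)
  also have "(\<Sum>i\<in>UNIV. \<Sum>j\<in>UNIV. F $ j $ i * V $ j * U $ i) = ip F V U"
    unfolding ip_def by (rule sum.swap)
  finally show ?thesis .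
qed

section \<open>The time-like eigenplane at one point\<close>

context
  fixes g F :: "real^4^4" and T :: "real^4"
  assumes g: "lorentzian g" and F: "transpose F = - F" and T: "ip g T T > 0" and kap: "kappa g F \<noteq> 0"
begin

private abbreviation "M v \<equiv> matrix_inv g *v (F *v v)"
private abbreviation "a \<equiv> kappa g F + psi g F / 2"
private abbreviation "b \<equiv> kappa g F - psi g F / 2"
private abbreviation "Y \<equiv> plane_projection g T F"
private abbreviation "X \<equiv> plane_observer g T F"
private abbreviation "W \<equiv> plane_normal g T F"

private lemma com: "ip g U V = ip g V U"
  by (rule ip_commute[OF lorentzian_sym[OF g]])

private lemma ip_M_right: "ip g U (M V) = ip F U V"
  using lorentzian_det[OF g] by (simp add: ip_eq_inner matrix_vector_mul_assoc matrix_mul_assoc matrix_inv_right)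

private lemma ip_M_left: "ip g (M U) V = - ip F U V"
  using com ip_M_right ip_skew[OF F] by metis

text \<open>\<open>- a\<close> and \<open>b\<close> are the roots of t^2 + psi t - phi^2/4, the
  Cayley-Hamilton polynomial in terms of t = M^2.\<close>

private lemma ab: "a \<ge> 0" "b \<ge> 0" "a * b = (phi g F)\<^sup>2 / 4" "a + b > 0"
proof -
  have k: "kappa g F \<ge> \<bar>psi g F\<bar> / 2"
    unfolding kappa_def using real_sqrt_sum_squares_ge1[of "\<bar>psi g F\<bar>" "phi g F"] by simp
  then show "a \<ge> 0" "b \<ge> 0" by auto
  show "a + b > 0" using k kap by auto
  have "(kappa g F)\<^sup>2 = ((psi g F)\<^sup>2 + (phi g F)\<^sup>2) / 4"
    by (simp add: kappa_def power_mult_distrib power_divide)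
  then show "a * b = (phi g F)\<^sup>2 / 4" by (simp add: power2_eq_square algebra_simps)
qed

private lemma MM_Y: "M (M Y) = b *\<^sub>R Y"
proof -
  have "M (M (M (M T))) = ((phi g F)\<^sup>2 / 4) *\<^sub>R T - psi g F *\<^sub>R M (M T)"
    using cayley_hamilton[OF g F, of T]
    by (simp add: algebra_simps flip: matrix_vector_mul_assoc)
  then have "M (M Y) = a *\<^sub>R M (M T) + ((a * b) *\<^sub>R T - psi g F *\<^sub>R M (M T))"
    unfolding plane_projection_def ab(3)
    by (simp add: matrix_vector_right_distrib matrix_vector_mult_scaleR)
  also have "\<dots> = b *\<^sub>R Y"
  proof -
    \<comment> \<open>At \<open>x = a\<close> and \<open>y = b\<close> the difference
      \<open>x - y\<close> is psi; stating the identity for atoms keeps \<open>a\<close> and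
      \<open>b\<close> folded.\<close>
    have "x *\<^sub>R u + ((x * y) *\<^sub>R t - (x - y) *\<^sub>R u) = y *\<^sub>R (x *\<^sub>R t + u)" for x y and t u :: "real^4"
      by (simp add: algebra_simps)
    from this[of a _ b] show ?thesis unfolding plane_projection_def by simp
  qed
  finally show ?thesis .
qed

text \<open>By skewness of \<open>M\<close> the product is a g(T,T) - g(MT,MT), and
  \<open>M T\<close> is orthogonal to \<open>T\<close>, hence space-like unless zero. If it is zero,
  then psi = a - b is nonnegative, and a + b > 0 forces a > 0.\<close>

private lemma ip_T_Y_pos: "ip g T Y > 0"
proof -
  have orth: "ip g T (M T) = 0" using ip_skew[OF F, of T T] by (simp add: ip_M_right)
  have eq: "ip g T Y = a * ip g T T - ip g (M T) (M T)"
    unfolding plane_projection_def ip_simps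
    by (simp only: ip_M_right ip_skew[OF F, of T "M T"])
  show ?thesis
  proof (cases "F *v T = 0")
    case True
    have "psi g F \<ge> 0" by (rule psi_nonneg[OF g F T True])
    then have "a > 0" using ab(4) by linarith
    then show ?thesis unfolding eq True using T by (simp add: ip_simps)
  next
    case False
    then have "M T \<noteq> 0"
      using matrix_vector_mul_assoc[of g "matrix_inv g" "F *v T"] matrix_inv_right[of g] lorentzian_det[OF g] by auto
    then have "ip g (M T) (M T) < 0" by (rule orthogonal_timelike[OF g T orth])
    then show ?thesis unfolding eq using ab(1) T by (smt (verit) mult_nonneg_nonneg)
  qed
qed

text \<open>Two applications of skewness make the square of \<open>M\<close> self-adjoint, so it can
  be moved onto its eigenvector \<open>Y\<close>.\<close>

private lemma ip_Y_Y: "ip g Y Y = (a + b) * ip g T Y"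
proof -
  have "ip g (M U) V = - ip g U (M V)" for U V
    by (simp only: ip_M_left ip_M_right)
  from this[of "M T" Y] this[of T "M Y"] have "ip g (M (M T)) Y = ip g T (M (M Y))" by (simp only: minus_minus)
  also have "\<dots> = b * ip g T Y" by (simp only: MM_Y ip_scaleR_right)
  finally have "ip g (M (M T)) Y = b * ip g T Y" .
  moreover have "ip g Y Y = a * ip g T Y + ip g (M (M T)) Y"
    using ip_add_left[of g "a *\<^sub>R T" "M (M T)" Y]
    by (simp only: plane_projection_def[of g T F, symmetric] ip_scaleR_left)
  ultimately show ?thesis by (simp add: algebra_simps)
qed

lemma ip_plane_projection_pos: "ip g Y Y > 0"
  unfolding ip_Y_Y using ab(4) ip_T_Y_pos by simp

lemma plane_observer: "ip g X X = 1" "ip g X T > 0"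
  using ip_plane_projection_pos ip_T_Y_pos com[of T Y] unfolding plane_observer_def Let_def ip_simps
  by (simp_all add: field_simps)

private lemma MM_X: "M (M X) = b *\<^sub>R X"
  unfolding plane_observer_def Let_def using MM_Y by (simp add: matrix_vector_mult_scaleR mult.commute)

lemma plane_normal:
  assumes "kappa g F - psi g F / 2 > 0"
  shows "ip g X W = 0" "ip g W W = -1" "ip F X V = - sqrt b * ip g W V" "ip F W V = - sqrt b * ip g X V"
proof -
  have MX: "M X = sqrt b *\<^sub>R W" using assms by (simp add: plane_normal_def)
  have "sqrt b *\<^sub>R M W = sqrt b *\<^sub>R (sqrt b *\<^sub>R X)"
    using MM_X assms unfolding MX by (simp add: matrix_vector_mult_scaleR)
  then have MW: "M W = sqrt b *\<^sub>R X" using assms by (simp del: scaleR_scaleR)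
  show X: "ip F X V = - sqrt b * ip g W V" for V
    using ip_M_left[of X V] by (simp add: MX ip_simps)
  show "ip F W V = - sqrt b * ip g X V" for V
    using ip_M_left[of W V] by (simp add: MW ip_simps)
  have "ip F X X = 0" using ip_skew[OF F, of X X] by simp
  then show "ip g X W = 0" using X[of X] assms com[of X W] by simp
  \<comment> \<open>F(W,X) is computed twice, from \<open>M X\<close> and from
    \<open>M W\<close>.\<close>
  have "sqrt b * ip g W W = sqrt b * (- ip g X X)"
    using ip_M_right[of W X] X[of W] ip_M_left[of W X] ip_skew[OF F, of X W] by (simp add: MX MW ip_simps)
  then show "ip g W W = -1" using assms plane_observer(1) unfolding mult_cancel_left by simp
qed

text \<open>The eigenplane determines every component of \<open>F\<close> with an index 0 or 1. The
  remaining component F(E,U) is unconstrained here and defines -\<beta>.\<close>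

lemma wrench_frame_local_tetrad:
  assumes pos: "kappa g F - psi g F / 2 > 0"
    and Z: "ip g (off_plane g T F V) (off_plane g T F V) < 0"
  shows "\<exists>\<beta>. wrench_frame g T F (local_tetrad g T F V) (sqrt (kappa g F - psi g F / 2)) \<beta>"
proof -
  let ?Z = "off_plane g T F V"
  define E where "E = inverse (sqrt (- ip g ?Z ?Z)) *\<^sub>R ?Z"
  let ?U = "cross4 g X W E"
  note n = plane_observer(1) plane_normal[OF pos]
  have "ip g X ?Z = 0" "ip g W ?Z = 0"
    using n com[of W X] by (simp_all add: off_plane_def ip_simps)
  then have XE: "ip g X E = 0" and WE: "ip g W E = 0" by (simp_all add: E_def ip_simps)
  have EE: "ip g E E = -1" using Z by (simp add: E_def ip_simps field_simps)
  note oc = orthonormal_completion[OF g n(1) n(2) XE n(3) WE EE]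
  have t: "vec_lambda (local_tetrad g T F V) = rows4 X W E ?U"
    by (simp add: vec_eq_iff all_4 local_tetrad_def Let_def E_def)
  have t0: "local_tetrad g T F V 0 = X" by (simp add: local_tetrad_def)
  have "ip g X ?U = 0" "ip g W ?U = 0"
    using arg_cong[OF oc(1), of "\<lambda>h. h $ 0 $ 3"] arg_cong[OF oc(1), of "\<lambda>h. h $ 1 $ 3"]
    by (simp_all add: congr_nth)
  then have F0: "ip F X W = sqrt b" "ip F X E = 0" "ip F X ?U = 0" "ip F W E = 0" "ip F W ?U = 0"
    using n XE WE by simp_all
  have "congr (rows4 X W E ?U) F = skew4 (sqrt b) 0 0 (- (- ip F E ?U)) 0 0"
    unfolding vec_eq_iff all_4 congr_nth
    using F0 ip_skew[OF F, of X X] ip_skew[OF F, of W W] ip_skew[OF F, of E E] ip_skew[OF F, of ?U ?U]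
     ip_skew[OF F, of W X] ip_skew[OF F, of E X] ip_skew[OF F, of ?U X] ip_skew[OF F, of E W]
     ip_skew[OF F, of ?U W] ip_skew[OF F, of ?U E]
    by simp
  then have "wrench_frame g T F (local_tetrad g T F V) (sqrt b) (- ip F E ?U)"
    unfolding wrench_frame_def t t0 using oc plane_observer(2) by simp
  then show ?thesis by blast
qed

lemma ex_off_plane_spacelike:
  assumes pos: "kappa g F - psi g F / 2 > 0"
  shows "\<exists>V. ip g (off_plane g T F V) (off_plane g T F V) < 0"
proof -
  have "card {X, W} \<le> 2" by (simp add: card_insert_if)
  then obtain V where V: "V \<notin> span {X, W}"
    using ex_not_in_span[of "{X, W}"] by auto
  have "off_plane g T F V \<noteq> 0"
  proof
    assume "off_plane g T F V = 0"
    then have "V = ip g X V *\<^sub>R X - ip g W V *\<^sub>R W" by (simp add: off_plane_def algebra_simps)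
    also have "\<dots> \<in> span {X, W}" by (intro span_diff span_scale span_base) auto
    finally show False using V by simp
  qed
  moreover have "ip g X (off_plane g T F V) = 0"
    using plane_observer(1) plane_normal[OF pos] by (simp add: off_plane_def ip_simps)
  ultimately show ?thesis using orthogonal_timelike[OF g] plane_observer(1) by (metis zero_less_one)
qed

end

section \<open>Smooth dependence on the point\<close>

lemma smooth_on_ip [smooth_intros]:
  "open S \<Longrightarrow> smooth_on S h \<Longrightarrow> smooth_on S V \<Longrightarrow> smooth_on S W \<Longrightarrow>
    smooth_on S (\<lambda>x. ip (h x) (V x) (W x))"
  unfolding ip_def by (intro smooth_intros)

lemma smooth_on_form_ip:
  assumes "open S" "\<And>x. x \<in> S \<Longrightarrow> det (g x) \<noteq> 0" "smooth_on S g" "smooth_on S G" "smooth_on S H"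
  shows "smooth_on S (\<lambda>x. form_ip (g x) (G x) (H x))"
  unfolding form_ip_def by (intro smooth_intros smooth_on_matrix_inv assms)

lemma smooth_on_hodge:
  assumes "open S" "\<And>x. x \<in> S \<Longrightarrow> det (g x) < 0" "smooth_on S g" "smooth_on S G"
  shows "smooth_on S (\<lambda>x. hodge (g x) (G x))"
proof -
  have "det (g x) \<noteq> 0" "- det (g x) > 0" if "x \<in> S" for x using assms(2)[OF that] by auto
  then show ?thesis
    unfolding hodge_def by (intro smooth_intros smooth_on_matrix_inv smooth_on_sqrt assms)
qed

lemma smooth_on_cross4:
  assumes "open S" "\<And>x. x \<in> S \<Longrightarrow> det (g x) < 0"
    "smooth_on S g" "smooth_on S u" "smooth_on S v" "smooth_on S w"
  shows "smooth_on S (\<lambda>x. cross4 (g x) (u x) (v x) (w x))"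
proof -
  have "det (g x) \<noteq> 0" "- det (g x) > 0" if "x \<in> S" for x using assms(2)[OF that] by auto
  moreover have "smooth_on S (\<lambda>x. if i = 0 then u x else if i = 1 then v x else if i = 2 then w x else axis a 1)"
    for i a :: 4
    using assms smooth_on_const by (cases "i = 0"; cases "i = 1"; cases "i = 2") auto
  ultimately show ?thesis
    unfolding cross4_def by (intro smooth_intros smooth_on_matrix_inv smooth_on_sqrt assms)
qed

text \<open>The pointwise hypotheses as seen in one chart, packaged so that they can be restricted
  to smaller open sets and passed on to the dual form.\<close>

locale regular_fields =
  fixes S :: "(real^4) set" and g F :: "real^4 \<Rightarrow> real^4^4" and T :: "real^4 \<Rightarrow> real^4"
  assumes S: "open S"
    and smooth: "smooth_on S g" "smooth_on S F" "smooth_on S T"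
    and lorentzian: "\<And>x. x \<in> S \<Longrightarrow> lorentzian (g x)"
    and skew: "\<And>x. x \<in> S \<Longrightarrow> transpose (F x) = - F x"
    and timelike: "\<And>x. x \<in> S \<Longrightarrow> ip (g x) (T x) (T x) > 0"
    and regular: "\<And>x. x \<in> S \<Longrightarrow> kappa (g x) (F x) \<noteq> 0"
begin

lemma det_neg: "x \<in> S \<Longrightarrow> det (g x) < 0"
  using lorentzian lorentzian_det by blast

lemma det_nz: "x \<in> S \<Longrightarrow> det (g x) \<noteq> 0"
  using det_neg by fastforce

lemma smooth_psi: "smooth_on S (\<lambda>x. psi (g x) (F x))"
  unfolding psi_def by (intro smooth_on_form_ip S smooth det_nz)

lemma smooth_hodge: "smooth_on S (\<lambda>x. hodge (g x) (F x))"
  by (intro smooth_on_hodge S smooth det_neg)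

text \<open>Regularity keeps the radicand positive, away from the point where the square root is not
  smooth.\<close>

lemma smooth_kappa: "smooth_on S (\<lambda>x. kappa (g x) (F x))"
proof -
  have "(psi (g x) (F x))\<^sup>2 + (phi (g x) (F x))\<^sup>2 > 0" if "x \<in> S" for x
    using regular[OF that] by (auto simp: kappa_def sum_power2_gt_zero_iff)
  moreover have "smooth_on S (\<lambda>x. phi (g x) (F x))"
    unfolding phi_def by (intro smooth_on_form_ip smooth_hodge S smooth det_nz)
  ultimately show ?thesis
    unfolding kappa_def power2_eq_square
    by (intro smooth_intros smooth_on_sqrt smooth_psi S) (simp_all add: power2_eq_square)
qed

lemma smooth_plane_observer: "smooth_on S (\<lambda>x. plane_observer (g x) (T x) (F x))"
proof -
  have proj: "smooth_on S (\<lambda>x. plane_projection (g x) (T x) (F x))"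
    unfolding plane_projection_def divide_inverse
    by (intro smooth_intros smooth_on_matrix_inv smooth_psi smooth_kappa S smooth det_nz)
  have pos: "ip (g x) (plane_projection (g x) (T x) (F x)) (plane_projection (g x) (T x) (F x)) > 0"
    if "x \<in> S" for x
    using ip_plane_projection_pos lorentzian skew timelike regular that by blast
  then have "sqrt (ip (g x) (plane_projection (g x) (T x) (F x)) (plane_projection (g x) (T x) (F x))) \<noteq> 0"
    if "x \<in> S" for x
    using that by fastforce
  with pos show ?thesis
    unfolding plane_observer_def Let_def
    by (intro smooth_intros smooth_on_inverse smooth_on_sqrt proj S smooth)
qed

lemma subset: "open S' \<Longrightarrow> S' \<subseteq> S \<Longrightarrow> regular_fields S' g F T"
  using S smooth lorentzian skew timelike regular
  by unfold_locales (auto intro: smooth_on_subset)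

lemma dual: "regular_fields S g (\<lambda>x. - hodge (g x) (F x)) T"
proof
  show "transpose (- hodge (g x) (F x)) = - (- hodge (g x) (F x))" if "x \<in> S" for x
  proof -
    have "transpose (- G) = - transpose G" for G :: "real^4^4" by (simp add: vec_eq_iff transpose_def)
    then show ?thesis using transpose_hodge[OF lorentzian skew, OF that that] by simp
  qed
  show "kappa (g x) (- hodge (g x) (F x)) \<noteq> 0" if "x \<in> S" for x
    using that by (simp add: kappa_dual lorentzian skew regular)
  show "smooth_on S (\<lambda>x. - hodge (g x) (F x))"
    by (intro smooth_on_minus smooth_hodge S)
qed (fact S smooth lorentzian timelike)+

end

text \<open>The assumed positive quantity is \<alpha>^2: the electric vector of the constructed
  observer is nonzero and can be normalised to \<open>plane_normal\<close>.\<close>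

locale nonmagnetic_fields = regular_fields +
  assumes nonmagnetic: "\<And>x. x \<in> S \<Longrightarrow> kappa (g x) (F x) - psi (g x) (F x) / 2 > 0"
begin

lemma smooth_plane_normal: "smooth_on S (\<lambda>x. plane_normal (g x) (T x) (F x))"
proof -
  let ?b = "\<lambda>x. kappa (g x) (F x) - psi (g x) (F x) / 2"
  have b: "smooth_on S ?b"
    unfolding divide_inverse by (intro smooth_on_diff smooth_on_mult smooth_on_const smooth_psi smooth_kappa S)
  have "smooth_on S (\<lambda>x. inverse (sqrt (?b x)))"
  proof (rule smooth_on_inverse[OF S _ smooth_on_sqrt[OF S _ b]])
    show "?b x > 0" if "x \<in> S" for x by (rule nonmagnetic[OF that])
    then show "sqrt (?b x) \<noteq> 0" if "x \<in> S" for x using that by fastforce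
  qed
  then show ?thesis
    unfolding plane_normal_def
    by (intro smooth_on_scaleR smooth_on_matrix_vector_mult smooth_on_matrix_inv
        smooth_plane_observer S smooth det_nz)
qed

lemma smooth_off_plane: "smooth_on S (\<lambda>x. off_plane (g x) (T x) (F x) V)"
  unfolding off_plane_def
  by (intro smooth_intros smooth_plane_observer smooth_plane_normal S smooth)

lemma smooth_local_tetrad:
  assumes neg: "\<And>x. x \<in> S \<Longrightarrow>
    ip (g x) (off_plane (g x) (T x) (F x) V) (off_plane (g x) (T x) (F x) V) < 0"
  shows "smooth_on S (\<lambda>x. local_tetrad (g x) (T x) (F x) V \<mu>)"
proof -
  let ?n = "\<lambda>x. - ip (g x) (off_plane (g x) (T x) (F x) V) (off_plane (g x) (T x) (F x) V)"
  have "?n x > 0" "sqrt (?n x) \<noteq> 0" if "x \<in> S" for x using neg[OF that] by auto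
  then have "smooth_on S (\<lambda>x. inverse (sqrt (?n x)) *\<^sub>R off_plane (g x) (T x) (F x) V)"
    by (intro smooth_intros smooth_on_inverse smooth_on_sqrt smooth_off_plane S smooth)
  then show ?thesis
    unfolding local_tetrad_def Let_def
    by (cases "\<mu> = 0"; cases "\<mu> = 1"; cases "\<mu> = 2")
      (auto intro!: smooth_on_cross4 smooth_plane_observer smooth_plane_normal S smooth det_neg)
qed

end

lemma (in regular_fields) ex_local_tetrad:
  assumes x0: "x0 \<in> S" "kappa (g x0) (F x0) - psi (g x0) (F x0) / 2 > 0"
  shows "\<exists>S' e. open S' \<and> x0 \<in> S' \<and> S' \<subseteq> S \<and> (\<forall>\<mu>. smooth_on S' (e \<mu>)) \<and>
    (\<forall>x\<in>S'. \<exists>\<alpha> \<beta>. wrench_frame (g x) (T x) (F x) (\<lambda>\<mu>. e \<mu> x) \<alpha> \<beta> \<and> \<alpha> > 0)"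
proof -
  let ?b = "\<lambda>x. kappa (g x) (F x) - psi (g x) (F x) / 2"
  define S1 where "S1 = S \<inter> ?b -` {0<..}"
  have "continuous_on S ?b"
    by (intro continuous_intros smooth_on_imp_continuous_on smooth_kappa smooth_psi) simp
  then have "open S1" unfolding S1_def by (rule continuous_open_preimage) (simp_all add: S)
  then interpret S1: regular_fields S1 g F T by (rule subset) (simp add: S1_def)
  interpret S1: nonmagnetic_fields S1 g F T by unfold_locales (simp add: S1_def)
  \<comment> \<open>\<open>V\<close> is chosen at \<open>x0\<close> only; by continuity its
    projection stays space-like nearby.\<close>
  obtain V where V: "ip (g x0) (off_plane (g x0) (T x0) (F x0) V) (off_plane (g x0) (T x0) (F x0) V) < 0"
    using ex_off_plane_spacelike[OF lorentzian skew timelike regular] x0 by blast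
  let ?n = "\<lambda>x. ip (g x) (off_plane (g x) (T x) (F x) V) (off_plane (g x) (T x) (F x) V)"
  define S2 where "S2 = S1 \<inter> ?n -` {..<0}"
  have "continuous_on S1 ?n"
    by (intro smooth_on_imp_continuous_on smooth_on_ip S1.smooth_off_plane S1.S S1.smooth)
  then have "open S2" unfolding S2_def by (rule continuous_open_preimage) (simp_all add: S1.S)
  then interpret S2: regular_fields S2 g F T by (rule S1.subset) (simp add: S2_def)
  interpret S2: nonmagnetic_fields S2 g F T by unfold_locales (simp add: S2_def S1_def)
  let ?e = "\<lambda>\<mu> x. local_tetrad (g x) (T x) (F x) V \<mu>"
  have "\<exists>\<alpha> \<beta>. wrench_frame (g x) (T x) (F x) (\<lambda>\<mu>. ?e \<mu> x) \<alpha> \<beta> \<and> \<alpha> > 0" if "x \<in> S2" for x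
  proof -
    have "?n x < 0" "?b x > 0" using that by (simp_all add: S2_def S1_def)
    with wrench_frame_local_tetrad[OF S2.lorentzian[OF that] S2.skew[OF that] S2.timelike[OF that]
        S2.regular[OF that], of V]
    show ?thesis using real_sqrt_gt_zero by blast
  qed
  moreover have "smooth_on S2 (?e \<mu>)" for \<mu>
    by (rule S2.smooth_local_tetrad) (simp add: S2_def)
  moreover have "x0 \<in> S2" "S2 \<subseteq> S" using x0 V by (auto simp: S1_def S2_def)
  ultimately show ?thesis using \<open>open S2\<close> by (intro exI[of _ S2] exI[of _ ?e]) blast
qed

text \<open>Where \<open>psi > 0\<close>, the electric vector may vanish; the tetrad then comes from the dual form
  \<open>- hodge g F\<close>, whose electric vector is the magnetic vector of \<open>F\<close>.\<close>
lemma (in regular_fields) ex_normalised_local_tetrad: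
  assumes x0: "x0 \<in> S"
  shows "\<exists>S' e. open S' \<and> x0 \<in> S' \<and> S' \<subseteq> S \<and> (\<forall>\<mu>. smooth_on S' (e \<mu>)) \<and>
    (\<forall>x\<in>S'. \<exists>\<alpha> \<beta>. wrench_frame (g x) (T x) (F x) (\<lambda>\<mu>. e \<mu> x) \<alpha> \<beta> \<and>
       (if psi (g x0) (F x0) \<le> 0 then \<alpha> > 0 else psi (g x) (F x) > 0 \<and> \<beta> > 0))"
proof (cases "psi (g x0) (F x0) \<le> 0")
  case True
  have "kappa (g x0) (F x0) > 0"
    using regular[OF x0] by (simp add: kappa_def sum_power2_gt_zero_iff)
  then show ?thesis using ex_local_tetrad[OF x0] True by auto
next
  case False
  \<comment> \<open>psi > 0 is an open condition, so the same normalisation applies on a whole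
    neighbourhood. In the other case psi may change sign nearby, and only \<alpha> > 0 is
    claimed.\<close>
  define S1 where "S1 = S \<inter> (\<lambda>x. psi (g x) (F x)) -` {0<..}"
  have "open S1"
    unfolding S1_def by (rule continuous_open_preimage)
      (simp_all add: S smooth_on_imp_continuous_on smooth_psi)
  then interpret S1: regular_fields S1 g F T by (rule subset) (simp add: S1_def)
  interpret dual: regular_fields S1 g "\<lambda>x. - hodge (g x) (F x)" T by (rule S1.dual)
  have x1: "x0 \<in> S1" using False x0 by (simp add: S1_def)
  have "kappa (g x0) (F x0) > 0"
    using regular[OF x0] by (simp add: kappa_def sum_power2_gt_zero_iff)
  \<comment> \<open>In terms of \<open>F\<close> this quantity is kappa + psi/2.\<close>
  then have "kappa (g x0) (- hodge (g x0) (F x0)) - psi (g x0) (- hodge (g x0) (F x0)) / 2 > 0"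
    using False by (simp add: kappa_dual psi_dual lorentzian skew x0)
  from dual.ex_local_tetrad[OF x1 this] obtain S' e
    where e: "open S'" "x0 \<in> S'" "S' \<subseteq> S1" "\<And>\<mu>. smooth_on S' (e \<mu>)"
      and w: "\<And>x. x \<in> S' \<Longrightarrow>
        \<exists>\<alpha> \<beta>. wrench_frame (g x) (T x) (- hodge (g x) (F x)) (\<lambda>\<mu>. e \<mu> x) \<alpha> \<beta> \<and> \<alpha> > 0"
    by blast
  have "\<exists>\<alpha> \<beta>. wrench_frame (g x) (T x) (F x) (\<lambda>\<mu>. e \<mu> x) \<alpha> \<beta> \<and> psi (g x) (F x) > 0 \<and> \<beta> > 0"
    if "x \<in> S'" for x
  proof -
    have "x \<in> S1" using that e(3) by blast
    then show ?thesis
      using w[OF that] wrench_frame_of_dual[OF _ S1.skew] by (fastforce simp: S1_def)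
  qed
  then show ?thesis using e False by (intro exI[of _ S'] exI[of _ e]) (auto simp: S1_def)
qed

section \<open>Charts\<close>

lemma
  assumes "is_chart c"
  shows chart_inv_left: "p \<in> fst c \<Longrightarrow> chart_inv c (snd c p) = p"
    and chart_inv_mem: "x \<in> snd c ` fst c \<Longrightarrow> chart_inv c x \<in> fst c"
  using assms unfolding is_chart_def homeomorphism_def by auto

lemma open_chart_vimage:
  assumes "is_chart c" "open S"
  shows "open (fst c \<inter> snd c -` S)"
proof (rule continuous_open_preimage)
  show "continuous_on (fst c) (snd c)" "open (fst c)"
    using assms(1) by (simp_all add: is_chart_def homeomorphism_def)
qed (rule assms(2))

lemma open_chart_image:
  assumes "is_chart c" "open U"
  shows "open (snd c ` (U \<inter> fst c))"
proof -
  have "snd c ` (U \<inter> fst c) = snd c ` fst c \<inter> chart_inv c -` U"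
    using chart_inv_left[OF assms(1)] by force
  moreover have "open (snd c ` fst c \<inter> chart_inv c -` U)"
  proof (rule continuous_open_preimage)
    show "continuous_on (snd c ` fst c) (chart_inv c)" "open (snd c ` fst c)"
      using assms(1) by (simp_all add: is_chart_def homeomorphism_def)
  qed (rule assms(2))
  ultimately show ?thesis by simp
qed

lemma coord_change_apply:
  "is_chart c \<Longrightarrow> p \<in> fst c \<Longrightarrow> coord_change c c' (snd c p) = snd c' p"
  by (simp add: coord_change_def chart_inv_left)

lemma
  assumes "oriented_atlas A" "c \<in> A"
  shows oriented_atlas_chart: "is_chart c"
    and oriented_atlas_smooth: "c' \<in> A \<Longrightarrow> smooth_on (snd c ` (fst c \<inter> fst c')) (coord_change c c')"
    and oriented_atlas_det: "c' \<in> A \<Longrightarrow> p \<in> fst c \<Longrightarrow> p \<in> fst c' \<Longrightarrow> det (jac c c' p) > 0"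
  using assms unfolding oriented_atlas_def by blast+

section \<open>Jacobians and transport of vector fields between charts\<close>

lemma jac_eq: "jac c c' p = matrix (frechet_derivative (coord_change c c') (at (snd c p)))"
  by (simp add: jac_def jacobian_def)

text \<open>The coordinate changes compose as expected only over the triple overlap; its image is
  open, which suffices for derivatives at the point.\<close>

lemma jac_chain:
  assumes A: "oriented_atlas A" "c \<in> A" "c' \<in> A" "c'' \<in> A"
    and p: "p \<in> fst c" "p \<in> fst c'" "p \<in> fst c''"
  shows "jac c c'' p = jac c' c'' p ** jac c c' p"
proof -
  note chart = oriented_atlas_chart[OF A(1)]
  have der: "(coord_change d d' has_derivative frechet_derivative (coord_change d d') (at (snd d p))) (at (snd d p))"
    if "d \<in> A" "d' \<in> A" "p \<in> fst d" "p \<in> fst d'" for d d'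
    by (rule smooth_on_imp_has_derivative[OF oriented_atlas_smooth[OF A(1)]]) (use that in auto)
  let ?D = "frechet_derivative (coord_change c c') (at (snd c p))"
    and ?D' = "frechet_derivative (coord_change c' c'') (at (snd c' p))"
  have "((\<lambda>x. coord_change c' c'' (coord_change c c' x)) has_derivative (\<lambda>v. ?D' (?D v))) (at (snd c p))"
    using der[OF A(3,4) p(2,3)] unfolding coord_change_apply[OF chart[OF A(2)] p(1), of c', symmetric]
    by (rule has_derivative_compose[OF der[OF A(2,3) p(1,2)]])
  moreover have "open (snd c ` ((fst c' \<inter> fst c'') \<inter> fst c))"
    using chart A by (intro open_chart_image open_Int) (auto simp: is_chart_def)
  moreover have "\<And>x. x \<in> snd c ` ((fst c' \<inter> fst c'') \<inter> fst c) \<Longrightarrow>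
      coord_change c' c'' (coord_change c c' x) = coord_change c c'' x"
    using A by (auto simp: coord_change_apply chart)
  moreover have "snd c p \<in> snd c ` ((fst c' \<inter> fst c'') \<inter> fst c)" using p by blast
  ultimately have "(coord_change c c'' has_derivative (\<lambda>v. ?D' (?D v))) (at (snd c p))"
    using has_derivative_transform_within_open by blast
  from frechet_derivative_at[OF this]
  have "frechet_derivative (coord_change c c'') (at (snd c p)) = ?D' \<circ> ?D"
    by (simp add: comp_def)
  then show ?thesis unfolding jac_eq
    using der[OF A(2,3) p(1,2)] der[OF A(3,4) p(2,3)]
    by (simp add: matrix_compose has_derivative_linear)
qed

lemma smooth_on_matrix_frechet_derivative:
  fixes f :: "real^4 \<Rightarrow> real^4"
  assumes "open S" "smooth_on S f"
  shows "smooth_on S (\<lambda>x. matrix (frechet_derivative f (at x)))"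
proof -
  have "(\<lambda>x. matrix (frechet_derivative f (at x))) = (\<lambda>x. \<chi> i j. partial_deriv j f x $ i)"
    by (simp add: matrix_def partial_deriv_def)
  then show ?thesis using assms by (auto intro!: smooth_intros smooth_on_partial_deriv)
qed

text \<open>Turns a vector field written in the coordinates of \<open>c0\<close> into its family of
  components in all charts.\<close>

definition transported :: "'m chart \<Rightarrow> (real^4 \<Rightarrow> real^4) \<Rightarrow> 'm vfield" where
  "transported c0 v c q = jac c0 c q *v v (snd c0 q)"

lemma vector_field_on_transported:
  assumes "oriented_atlas A" "c0 \<in> A" "U \<subseteq> fst c0"
  shows "vector_field_on A U (transported c0 v)"
  unfolding vector_field_on_def transported_def
proof (intro ballI)
  fix c c' p assume c: "c \<in> A" "c' \<in> A" "p \<in> U \<inter> fst c \<inter> fst c'"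
  have "jac c0 c' p = jac c c' p ** jac c0 c p"
    by (rule jac_chain[OF assms(1,2) c(1,2)]) (use c(3) assms(3) in auto)
  then show "jac c0 c' p *v v (snd c0 p) = jac c c' p *v (jac c0 c p *v v (snd c0 p))"
    by (simp add: matrix_vector_mul_assoc)
qed

lemma smooth_field_on_transported:
  assumes A: "oriented_atlas A" "c0 \<in> A" and U: "open U" "U \<subseteq> fst c0"
    and v: "smooth_on S v" "snd c0 ` U \<subseteq> S"
  shows "smooth_field_on A U (transported c0 v)"
  unfolding smooth_field_on_def
proof
  fix c assume c: "c \<in> A"
  note chart = oriented_atlas_chart[OF A(1) c] oriented_atlas_chart[OF A]
  let ?S = "snd c ` (U \<inter> fst c)" and ?R = "snd c0 ` (fst c0 \<inter> fst c)"
  let ?J = "\<lambda>x. matrix (frechet_derivative (coord_change c0 c) (at x))"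
  have oS: "open ?S" by (rule open_chart_image[OF chart(1) U(1)])
  have "open (snd c0 ` (fst c \<inter> fst c0))"
    by (rule open_chart_image[OF chart(2)]) (use chart(1) in \<open>simp add: is_chart_def\<close>)
  then have "open ?R" by (simp only: Int_commute)
  then have J: "smooth_on ?R ?J"
    by (rule smooth_on_matrix_frechet_derivative[OF _ oriented_atlas_smooth[OF A c]])
  have cc: "smooth_on ?S (coord_change c c0)"
    by (rule smooth_on_subset[OF oriented_atlas_smooth[OF A(1) c A(2)]]) (use U(2) in blast)
  have eq: "coord_change c c0 (snd c q) = snd c0 q" if "q \<in> U \<inter> fst c" for q
    using that coord_change_apply[OF chart(1)] by blast
  have im: "coord_change c c0 ` ?S \<subseteq> ?R" "coord_change c c0 ` ?S \<subseteq> S"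
    using eq U(2) v(2) by (simp_all add: image_subset_iff) blast+
  have "smooth_on ?S (\<lambda>x. ?J (coord_change c c0 x) *v v (coord_change c c0 x))"
    using smooth_on_compose[OF oS im(1) J cc] smooth_on_compose[OF oS im(2) v(1) cc]
    by (rule smooth_on_matrix_vector_mult[OF oS])
  then show "smooth_on ?S (\<lambda>x. transported c0 v c (chart_inv c x))"
  proof (rule smooth_on_cong[OF oS, rotated])
    fix x assume "x \<in> ?S"
    then obtain q where q: "q \<in> U \<inter> fst c" "x = snd c q" by blast
    then have "chart_inv c x = q" using chart_inv_left[OF chart(1)] by blast
    then show "?J (coord_change c c0 x) *v v (coord_change c c0 x) = transported c0 v c (chart_inv c x)"
      unfolding transported_def jac_eq q(2) eq[OF q(1)] by simp
  qed
qed

lemma cov_tensor_field_congr: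
  "cov_tensor_field A G \<Longrightarrow> c \<in> A \<Longrightarrow> c' \<in> A \<Longrightarrow> p \<in> fst c \<Longrightarrow> p \<in> fst c' \<Longrightarrow>
    G c p = congr (transpose (jac c c' p)) (G c' p)"
  unfolding cov_tensor_field_def congr_def transpose_transpose by blast

text \<open>The sign of psi selects the normalisation, so it must not depend on the chart in which
  it is evaluated.\<close>

lemma psi_chart_independent:
  assumes A: "oriented_atlas A" and g: "cov_tensor_field A g" "\<And>c p. c \<in> A \<Longrightarrow> p \<in> fst c \<Longrightarrow> lorentzian (g c p)"
    and F: "cov_tensor_field A F"
    and c: "c \<in> A" "c' \<in> A" "p \<in> fst c" "p \<in> fst c'"
  shows "psi (g c p) (F c p) = psi (g c' p) (F c' p)"
proof -
  have "det (jac c c' p) > 0" using oriented_atlas_det[OF A] c by blast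
  then have "det (transpose (jac c c' p)) \<noteq> 0" by (simp add: det_transpose)
  moreover have "det (g c' p) \<noteq> 0" using lorentzian_det[OF g(2)[OF c(2,4)]] by simp
  ultimately show ?thesis
    unfolding cov_tensor_field_congr[OF g(1) c] cov_tensor_field_congr[OF F c] by (rule psi_congr)
qed

theorem mainTheorem5:
  fixes A :: "'m::{t2_space,second_countable_topology} chart set"
    and g F :: "'m tfield" and T :: "'m vfield"
  assumes "spacetime A g T"
    and "two_form A F"
    and "regular_form A g F"
    and "maxwell_solution A g F"
  shows
    "(\<exists>e :: 4 \<Rightarrow> 'm vfield.
        (\<forall>\<mu>. vector_field_on A UNIV (e \<mu>)) \<and>
        (\<forall>c\<in>A. \<forall>p \<in> fst c. adapted_tetrad (g c p) (T c p) (F c p) (\<lambda>\<mu>. e \<mu> c p)))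
     \<and>
     (\<forall>p. \<exists>U. \<exists>e :: 4 \<Rightarrow> 'm vfield. open U \<and> p \<in> U \<and>
        (\<forall>\<mu>. vector_field_on A U (e \<mu>) \<and> smooth_field_on A U (e \<mu>)) \<and>
        (\<forall>c\<in>A. \<forall>q \<in> U \<inter> fst c.
           adapted_tetrad (g c q) (T c q) (F c q) (\<lambda>\<mu>. e \<mu> c q) \<or>
           (\<exists>c'\<in>A. p \<in> fst c' \<and>
              (psi (g c q) (F c q) \<le> 0) \<noteq> (psi (g c' p) (F c' p) \<le> 0)) \<and>
           adapted_tetrad (g c q) (T c q) (F c q)
             (reverse_wrench (\<lambda>\<mu>. e \<mu> c q))))" (is "_ \<and> (\<forall>p. \<exists>U e. ?local p U e)")
proof -
  have A: "oriented_atlas A" and g: "cov_tensor_field A g" "smooth_field_on A UNIV g"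
    and lor: "\<And>c p. c \<in> A \<Longrightarrow> p \<in> fst c \<Longrightarrow> lorentzian (g c p)"
    and T: "vector_field_on A UNIV T" "smooth_field_on A UNIV T"
    and tl: "\<And>c p. c \<in> A \<Longrightarrow> p \<in> fst c \<Longrightarrow> ip (g c p) (T c p) (T c p) > 0"
    using assms(1) unfolding spacetime_def timelike_def by blast+
  have F: "cov_tensor_field A F" "smooth_field_on A UNIV F"
    and skew: "\<And>c p a b. c \<in> A \<Longrightarrow> p \<in> fst c \<Longrightarrow> F c p $ a $ b = - F c p $ b $ a"
    using assms(2) unfolding two_form_def by blast+
  have kap: "\<And>c p. c \<in> A \<Longrightarrow> p \<in> fst c \<Longrightarrow> kappa (g c p) (F c p) \<noteq> 0"
    using assms(3) unfolding regular_form_def by blast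
  note psi_indep = psi_chart_independent[OF A g(1) lor F(1)]
  have loc: "\<exists>U e. ?local p U e" for p
  proof -
    obtain c0 where c0: "c0 \<in> A" "p \<in> fst c0"
      using A unfolding oriented_atlas_def by blast
    have chart: "is_chart c0" by (rule oriented_atlas_chart[OF A c0(1)])
    let ?S = "snd c0 ` fst c0" and ?i = "chart_inv c0"
    interpret regular_fields ?S "\<lambda>x. g c0 (?i x)" "\<lambda>x. F c0 (?i x)" "\<lambda>x. T c0 (?i x)"
    proof
      show "open ?S" using chart by (simp add: is_chart_def)
      show "smooth_on ?S (\<lambda>x. g c0 (?i x))" "smooth_on ?S (\<lambda>x. F c0 (?i x))"
        "smooth_on ?S (\<lambda>x. T c0 (?i x))"
        using g(2) F(2) T(2) c0(1) by (simp_all add: smooth_field_on_def)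
      fix x assume x: "x \<in> ?S"
      note m = c0(1) chart_inv_mem[OF chart x]
      show "lorentzian (g c0 (?i x))" "ip (g c0 (?i x)) (T c0 (?i x)) (T c0 (?i x)) > 0"
        "kappa (g c0 (?i x)) (F c0 (?i x)) \<noteq> 0"
        using lor[OF m] tl[OF m] kap[OF m] by auto
      show "transpose (F c0 (?i x)) = - F c0 (?i x)"
        by (simp add: vec_eq_iff transpose_def) (intro allI skew[OF m])
    qed
    have p: "snd c0 p \<in> ?S" "?i (snd c0 p) = p" using c0 chart_inv_left[OF chart] by auto
    from ex_normalised_local_tetrad[OF p(1)] obtain S' e
      where S': "open S'" "snd c0 p \<in> S'" "S' \<subseteq> ?S"
        and e: "\<And>\<mu>. smooth_on S' (e \<mu>)"
        and w: "\<And>x. x \<in> S' \<Longrightarrow> \<exists>\<alpha> \<beta>. wrench_frame (g c0 (?i x)) (T c0 (?i x)) (F c0 (?i x)) (\<lambda>\<mu>. e \<mu> x) \<alpha> \<beta> \<and>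
          (if psi (g c0 p) (F c0 p) \<le> 0 then \<alpha> > 0 else psi (g c0 (?i x)) (F c0 (?i x)) > 0 \<and> \<beta> > 0)"
      unfolding p(2) by blast
    define U where "U = fst c0 \<inter> snd c0 -` S'"
    define E where "E \<mu> = transported c0 (e \<mu>)" for \<mu>
    have U: "open U" "p \<in> U" "U \<subseteq> fst c0" "snd c0 ` U \<subseteq> S'"
      using open_chart_vimage[OF chart S'(1)] c0 S' by (auto simp: U_def)
    have fields: "vector_field_on A U (E \<mu>)" "smooth_field_on A U (E \<mu>)" for \<mu>
      unfolding E_def
      using vector_field_on_transported[OF A c0(1) U(3)]
        smooth_field_on_transported[OF A c0(1) U(1,3) e U(4)] by auto
    have "adapted_tetrad (g c q) (T c q) (F c q) (\<lambda>\<mu>. E \<mu> c q) \<or>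
           (\<exists>c'\<in>A. p \<in> fst c' \<and> (psi (g c q) (F c q) \<le> 0) \<noteq> (psi (g c' p) (F c' p) \<le> 0)) \<and>
           adapted_tetrad (g c q) (T c q) (F c q) (reverse_wrench (\<lambda>\<mu>. E \<mu> c q))"
      if c: "c \<in> A" "q \<in> U" "q \<in> fst c" for c q
    proof -
      have q: "q \<in> fst c0" "?i (snd c0 q) = q" "snd c0 q \<in> S'"
        using c(2) chart_inv_left[OF chart] by (auto simp: U_def)
      let ?J = "jac c0 c q"
      have J: "det ?J > 0" by (rule oriented_atlas_det[OF A c0(1) c(1) q(1) c(3)])
      have tr: "g c0 q = transpose ?J ** g c q ** ?J" "F c0 q = transpose ?J ** F c q ** ?J"
        "T c q = ?J *v T c0 q"
        using g(1) F(1) T(1) c0(1) c q(1)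
        unfolding cov_tensor_field_def vector_field_on_def by blast+
      obtain \<alpha> \<beta> where w0: "wrench_frame (g c0 q) (T c0 q) (F c0 q) (\<lambda>\<mu>. e \<mu> (snd c0 q)) \<alpha> \<beta>"
        and sgn: "if psi (g c0 p) (F c0 p) \<le> 0 then \<alpha> > 0 else psi (g c0 q) (F c0 q) > 0 \<and> \<beta> > 0"
        using w[OF q(3)] unfolding q(2) by blast
      \<comment> \<open>The coefficients are the same in chart \<open>c\<close> as in
        \<open>c0\<close>, so their signs are settled in \<open>c0\<close>.\<close>
      have W: "wrench_frame (g c q) (T c q) (F c q) (\<lambda>\<mu>. E \<mu> c q) \<alpha> \<beta>"
        using wrench_frame_coord_change[OF w0[unfolded tr(1,2)] J]
        unfolding E_def transported_def tr(3) .
      have psi: "psi (g c0 q) (F c0 q) = psi (g c q) (F c q)"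
        by (rule psi_indep) (use c c0 q in auto)
      note k = kap[OF c(1,3)]
      show ?thesis
      proof (cases "psi (g c0 p) (F c0 p) \<le> 0")
        case False
        then show ?thesis using wrench_frame_imp_adapted_tetrad[OF W k] sgn psi by simp
      next
        case True
        then have \<alpha>: "\<alpha> > 0" using sgn by simp
        show ?thesis
        proof (cases "psi (g c q) (F c q) > 0 \<and> \<beta> \<le> 0")
          case False
          then show ?thesis using wrench_frame_imp_adapted_tetrad[OF W k] \<alpha> by auto
        next
          case rev: True
          \<comment> \<open>psi = \<beta>^2 - \<alpha>^2 > 0 excludes \<beta> = 0, so after the
            reversal -\<beta> is positive. The sign of psi differs from that at \<open>p\<close>,
            with \<open>c0\<close> as witness chart.\<close>
          have "\<beta> \<noteq> 0" using rev wrench_frame_psi[OF W] by auto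
          then have "adapted_tetrad (g c q) (T c q) (F c q) (reverse_wrench (\<lambda>\<mu>. E \<mu> c q))"
            using wrench_frame_imp_adapted_tetrad[OF wrench_frame_reverse_wrench[OF W] k] rev by auto
          then show ?thesis using True rev c0 by (intro disjI2 conjI bexI[of _ c0]) auto
        qed
      qed
    qed
    then have "?local p U E" using U(1,2) fields by blast
    then show ?thesis by blast
  qed
  then have "\<forall>p. \<exists>Ue. ?local p (fst Ue) (snd Ue)" by simp
  from choice[OF this] obtain Ue where Ue: "\<And>p. ?local p (fst (Ue p)) (snd (Ue p))" by blast
  \<comment> \<open>At each point the tetrad comes from the neighbourhood chosen for that very
    point. This may break continuity, but the transformation law relates components at a single
    point and survives.\<close>
  define e where "e \<mu> c p = snd (Ue p) \<mu> c p" for \<mu> c p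
  have "vector_field_on A UNIV (e \<mu>)" for \<mu>
    unfolding vector_field_on_def
  proof (intro ballI)
    fix c c' p assume c: "c \<in> A" "c' \<in> A" "p \<in> UNIV \<inter> fst c \<inter> fst c'"
    have "vector_field_on A (fst (Ue p)) (snd (Ue p) \<mu>)" "p \<in> fst (Ue p)"
      using Ue[of p] by blast+
    then show "e \<mu> c' p = jac c c' p *v e \<mu> c p"
      using c unfolding vector_field_on_def e_def by blast
  qed
  moreover have "adapted_tetrad (g c p) (T c p) (F c p) (\<lambda>\<mu>. e \<mu> c p)" if c: "c \<in> A" "p \<in> fst c" for c p
  proof -
    have "psi (g c p) (F c p) = psi (g c' p) (F c' p)" if "c' \<in> A" "p \<in> fst c'" for c'
      by (rule psi_indep) (use c that in auto)
    \<comment> \<open>At the centre of its own neighbourhood psi is compared with itself, so the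
      reversed alternative is excluded.\<close>
    then have "\<not> (\<exists>c'\<in>A. p \<in> fst c' \<and> (psi (g c p) (F c p) \<le> 0) \<noteq> (psi (g c' p) (F c' p) \<le> 0))"
      by metis
    moreover have "p \<in> fst (Ue p) \<inter> fst c" using Ue[of p] c(2) by blast
    ultimately show ?thesis
      using Ue[of p] c(1) unfolding e_def by blast
  qed
  ultimately have "\<exists>e. (\<forall>\<mu>. vector_field_on A UNIV (e \<mu>)) \<and>
      (\<forall>c\<in>A. \<forall>p\<in>fst c. adapted_tetrad (g c p) (T c p) (F c p) (\<lambda>\<mu>. e \<mu> c p))"
    by (intro exI[of _ e]) blast
  then show ?thesis by (rule conjI[OF _ allI[OF loc]])
qed

end
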